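(* Let $n\ge 1$, let $\theta:\mathbb{R}^n\to[0,\infty)$ be a decreasing radial function with $\lim_{|y|\to\infty}\theta(y)=0$, and let $$S=\sum_{m\in\mathbb{N}}\frac{\theta(m)}{m},$$ where for a natural number $m$, $\theta(m)$ denotes the value of $\theta$ at any point of norm $m$. (a) Let $f\in L^1(\mathbb{T}^n)$ be a function for which there is a constant $C$ such that $$|\widehat f(m)|\le C e^{-\theta(m)|m|}\quad\text{for all } m\in\mathbb{Z}^n. \qquad ( * )$$ If $f$ vanishes on some nonempty open set $U\subset\mathbb{T}^n$ and $S=\infty$, then $f=0$ almost everywhere on $\mathbb{T}^n$. (b) If $S$ is finite, then for any given nonempty open set $U\subset\mathbb{T}^n$ there exists a nontrivial $f\in L^1(\mathbb{T}^n)$ supported in $U$ and satisfying $( * )$ for some constant $C$.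
   Context: $\mathbb{T}^n=\{(e^{2\pi i x_1},\dots,e^{2\pi i x_n}) : (x_1,\dots,x_n)\in[0,1]^n\}$ is identified with $[0,1]^n$ (with periodic identification of the boundary). For $f\in L^1(\mathbb{T}^n)$, $\widehat f(m)=\int_{\mathbb{T}^n}f(x)e^{-2\pi i m\cdot x}\,dx$, $m\in\mathbb{Z}^n$. $|m|$ is the Euclidean norm. A radial function $\theta$ is decreasing if $\theta(y)$ is a decreasing function of $|y|$; a radial function on $\mathbb{R}^n$ is also viewed as a function on $[0,\infty)$. *)

theory Defs
  imports "HOL-Analysis.Analysis"
begin

section \<open>The torus\<close>

definition torus :: "(complex ^ 'n::finite) set" where
  "torus = {z. \<forall>i. norm (z $ i) = 1}"

definition torus_point :: "real ^ 'n \<Rightarrow> complex ^ 'n::finite" where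
  "torus_point x = (\<chi> i. exp (2 * of_real pi * \<i> * of_real (x $ i)))"

lemma torus_eq: "torus = torus_point ` {x. \<forall>i. 0 \<le> x $ i \<and> x $ i \<le> 1}"
proof (intro equalityI subsetI)
  fix z :: "complex ^ 'n" assume z: "z \<in> torus"
  have "\<exists>t. 0 \<le> t \<and> t \<le> 1 \<and> z $ i = exp (2 * of_real pi * \<i> * of_real t)" for i
  proof -
    have "norm (z $ i) = 1" using z by (simp add: torus_def)
    then have "z $ i = exp (\<i> * of_real (Arg2pi (z $ i)))"
      using Arg2pi_eq[of "z $ i"] by simp
    then show ?thesis
      using Arg2pi[of "z $ i"]
      by (intro exI[of _ "Arg2pi (z $ i) / (2 * pi)"]) (simp add: field_simps)
  qed
  then obtain t where t: "\<And>i. 0 \<le> t i \<and> t i \<le> 1 \<and> z $ i = exp (2 * of_real pi * \<i> * of_real (t i))"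
    by metis
  then have "z = torus_point (\<chi> i. t i)"
    by (simp add: vec_eq_iff torus_point_def)
  moreover have "(\<chi> i. t i) \<in> {x. \<forall>i. 0 \<le> x $ i \<and> x $ i \<le> 1}" using t by simp
  ultimately show "z \<in> torus_point ` {x. \<forall>i. 0 \<le> x $ i \<and> x $ i \<le> 1}" by blast
qed (auto simp: torus_def torus_point_def)

text \<open>
  A function on the torus is a function on \<open>complex ^ 'n\<close> of which only the values on
  \<^const>\<open>torus\<close> are used.  Measure and integral are those of Lebesgue measure on the
  cube \<open>[0,1]^n\<close>, transported by \<^const>\<open>torus_point\<close>.
\<close>

definition unit_cube :: "(real ^ 'n::finite) set" where
  "unit_cube = cbox 0 (vec 1)"

definition torus_AE :: "(complex ^ 'n::finite \<Rightarrow> bool) \<Rightarrow> bool" where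
  "torus_AE P \<longleftrightarrow> (AE x in lebesgue_on unit_cube. P (torus_point x))"

definition torus_L1 :: "(complex ^ 'n::finite \<Rightarrow> complex) \<Rightarrow> bool" where
  "torus_L1 f \<longleftrightarrow> integrable (lebesgue_on unit_cube) (\<lambda>x. f (torus_point x))"

definition lattice_vec :: "int ^ 'n \<Rightarrow> real ^ 'n::finite" where
  "lattice_vec m = (\<chi> i. of_int (m $ i))"

definition fourier_coeff :: "(complex ^ 'n::finite \<Rightarrow> complex) \<Rightarrow> int ^ 'n \<Rightarrow> complex" where
  "fourier_coeff f m =
     (LINT x | lebesgue_on unit_cube.
        f (torus_point x) * exp (- 2 * of_real pi * \<i> * of_real (lattice_vec m \<bullet> x)))"

text \<open>The torus is closed, so this closure is also the closure relative to the torus.\<close>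

definition torus_support :: "(complex ^ 'n::finite \<Rightarrow> complex) \<Rightarrow> (complex ^ 'n) set" where
  "torus_support f = closure {z \<in> torus. f z \<noteq> 0}"

section \<open>Radial functions\<close>

definition radial :: "(real ^ 'n::finite \<Rightarrow> real) \<Rightarrow> bool" where
  "radial \<theta> \<longleftrightarrow> (\<forall>x y. norm x = norm y \<longrightarrow> \<theta> x = \<theta> y)"

text \<open>``Decreasing'' is meant in the weak sense (non-increasing).\<close>

definition radially_decreasing :: "(real ^ 'n::finite \<Rightarrow> real) \<Rightarrow> bool" where
  "radially_decreasing \<theta> \<longleftrightarrow> (\<forall>x y. norm x \<le> norm y \<longrightarrow> \<theta> y \<le> \<theta> x)"

definition radial_value :: "(real ^ 'n::finite \<Rightarrow> real) \<Rightarrow> real \<Rightarrow> real" where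
  "radial_value \<theta> r = (THE v. \<forall>y. norm y = r \<longrightarrow> \<theta> y = v)"

lemma radial_value_norm: "radial \<theta> \<Longrightarrow> radial_value \<theta> (norm y) = \<theta> y"
  unfolding radial_value_def radial_def by (rule the_equality) metis+

text \<open>The sum over the positive integers, as an element of \<open>[0,\<infinity>]\<close>.\<close>

definition log_sum :: "(real ^ 'n::finite \<Rightarrow> real) \<Rightarrow> ennreal" where
  "log_sum \<theta> = (\<Sum>k. ennreal (radial_value \<theta> (real (Suc k)) / real (Suc k)))"

definition fourier_decay ::
  "(real ^ 'n::finite \<Rightarrow> real) \<Rightarrow> (complex ^ 'n \<Rightarrow> complex) \<Rightarrow> bool" where
  "fourier_decay \<theta> f \<longleftrightarrow>
     (\<exists>C::real. \<forall>m. norm (fourier_coeff f m)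
        \<le> C * exp (- (\<theta> (lattice_vec m) * norm (lattice_vec m))))"

end

theory Submission
  imports Defs "HOL-Real_Asymp.Real_Asymp"
begin

text \<open>
Part (a) says that the bound on the Fourier coefficients makes \<open>f\<close> quasi-analytic in a weak sense.  The
bound alone need not make \<open>f\<close> smooth: the product \<open>\<theta>(m) \<bar>m\<bar>\<close> can be small at isolated scales although
the sum \<open>S\<close> diverges.  Following Ingham, one therefore convolves \<open>f\<close> with a bump \<open>u\<close> of very small
support and with Fourier transform \<open>O(exp (-2 \<surd>\<bar>m\<bar>))\<close>.  The convolution
\<open>G(x) = \<Sum> f^(m) u^(m) exp (2 \<pi> i m \<cdot> x)\<close> still vanishes on an open set, and it is smooth.  On a line
through a point of that set its \<open>k\<close>-th derivative is bounded by a constant times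
\<open>\<mu>\<^sub>1 \<dots> \<mu>\<^sub>k\<close> with \<open>\<mu>\<^sub>j\<close> proportional to \<open>j / \<theta>(j\<^sup>4)\<close> (lemma \<open>power_le_weights\<close>), and the reciprocals of
the \<open>\<mu>\<^sub>j\<close> have a divergent sum because \<open>S\<close> diverges (lemma \<open>not_summable_inverse_weight\<close>).  The
Denjoy--Carleman theorem, for which Bang found an elementary proof by Taylor's formula
(\<open>denjoy_carleman_bang\<close>), shows that \<open>G\<close> vanishes on every such line, hence everywhere.  So
\<open>f^(m) u^(m) = 0\<close> for all \<open>m\<close>.  Given \<open>a\<close>, the support of \<open>u\<close> can be taken so small that
\<open>u^(a) \<noteq> 0\<close>; hence all Fourier coefficients of \<open>f\<close> are 0, and \<open>f = 0\<close> almost everywhere by the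
uniqueness theorem (\<open>fourier_uniqueness_cube\<close>).

For part (b) one averages a cone-shaped bump successively over infinitely many segments in the coordinate
directions, with lengths proportional to \<open>\<theta>(k) / k\<close>.  The convergence of \<open>S\<close> says that the total length
is finite, and it is small after the omission of finitely many segments, so the limit is a bump with
small support.  Averaging over a segment \<open>v\<close> multiplies the Fourier transform at \<open>m\<close> by a factor
of modulus at most \<open>1\<close> and at most \<open>1 / (\<pi> \<bar>m \<cdot> v\<bar>)\<close>; about \<open>\<theta>(m) \<bar>m\<bar>\<close> of these factors are at most
\<open>1 / e\<close>, which is the required decay (\<open>ingham_bump\<close>).  The bump needed in part (a) is the case
\<open>\<theta>(r) = 2 / \<surd>r\<close> of the same construction.
\<close>

section \<open>The Denjoy--Carleman theorem\<close>

lemma exp_partial_sum_le: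
  fixes y :: real
  assumes "0 \<le> y" "finite S"
  shows "(\<Sum>m\<in>S. y ^ m / fact m) \<le> exp y"
proof -
  have "(\<Sum>m\<in>S. y ^ m / fact m) = (\<Sum>m\<in>S. y ^ m /\<^sub>R fact m)"
    by (simp add: divide_inverse mult.commute)
  also have "\<dots> \<le> exp y"
    unfolding exp_def using assms by (intro sum_le_suminf summable_exp_generic) auto
  finally show ?thesis .
qed

text \<open>
Bang's argument measures the flatness of a smooth function at \<open>x\<close> by the supremum of
\<open>\<bar>D k x\<bar> / (e\<^sup>k M\<^sub>k)\<close> over all \<open>k\<close>, where \<open>M\<^sub>k\<close> is the product of the first \<open>k\<close> weights.  If this
quantity is at most \<open>A e\<close> to the power \<open>-(N+1)\<close> at \<open>x\<close>, it can grow by at most one factor \<open>e\<close> over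
the distance \<open>1 / (e \<mu>\<^sub>N)\<close>.  For derivatives of order above \<open>N\<close> the global bound suffices, because
the factor \<open>e\<^sup>k\<close> has been given away; for lower orders one takes the Taylor polynomial at \<open>x\<close> up to
order \<open>N + 1\<close> and uses that the weights up to \<open>\<mu>\<^sub>N\<close> are at most \<open>\<mu>\<^sub>N\<close>, so that the Taylor terms
are dominated by those of the exponential series.
\<close>

lemma bang_step:
  fixes D :: "nat \<Rightarrow> real \<Rightarrow> real" and \<mu> :: "nat \<Rightarrow> real" and N :: nat
  assumes der: "\<And>k t. (D k has_real_derivative D (Suc k) t) (at t)"
    and bnd: "\<And>k t. \<bar>D k t\<bar> \<le> A * (\<Prod>j<k. \<mu> j)"
    and pos: "\<And>j. 0 < \<mu> j" and mono: "\<And>i j. i \<le> j \<Longrightarrow> \<mu> i \<le> \<mu> j"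
    and A: "0 \<le> A"
    and x: "\<And>k. \<bar>D k x\<bar> \<le> A * (\<Prod>j<k. \<mu> j) * exp (real k - real (Suc N))"
    and h: "0 \<le> h" "h \<le> 1 / (exp 1 * \<mu> N)"
  shows "\<bar>D k (x + h)\<bar> \<le> A * (\<Prod>j<k. \<mu> j) * exp (real k - real N)"
proof (cases "h = 0 \<or> N < k")
  case True
  then show ?thesis
  proof
    assume "h = 0"
    have "A * (\<Prod>j<k. \<mu> j) * exp (real k - real (Suc N)) \<le> A * (\<Prod>j<k. \<mu> j) * exp (real k - real N)"
      using A pos by (intro mult_left_mono mult_nonneg_nonneg prod_nonneg) (auto intro: less_imp_le)
    with x[of k] \<open>h = 0\<close> show ?thesis by simp
  next
    assume "N < k"
    have "A * (\<Prod>j<k. \<mu> j) * 1 \<le> A * (\<Prod>j<k. \<mu> j) * exp (real k - real N)"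
      using A pos \<open>N < k\<close> by (intro mult_left_mono mult_nonneg_nonneg prod_nonneg) (auto intro: less_imp_le)
    with bnd[of k "x + h"] show ?thesis by simp
  qed
next
  case False
  then have h0: "0 < h" and kN: "k \<le> N" using h by auto
  define p where "p = Suc N - k"
  have p: "0 < p" "k + p = Suc N" using kN by (auto simp: p_def)
  define M where "M = (\<lambda>k. \<Prod>j<k. \<mu> j)"
  have Mpos: "0 < M k" for k unfolding M_def using pos by (intro prod_pos) auto
  have Mgrow: "j \<le> p \<Longrightarrow> M (k + j) \<le> M k * \<mu> N ^ j" for j
  proof (induction j)
    case (Suc j)
    have "M (k + Suc j) = M (k + j) * \<mu> (k + j)" by (simp add: M_def)
    also have "\<dots> \<le> (M k * \<mu> N ^ j) * \<mu> N"
      using Suc p mono[of "k + j" N] pos Mpos less_imp_le[OF pos] less_imp_le[OF Mpos]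
      by (intro mult_mono) auto
    finally show ?case by (simp add: mult_ac)
  qed simp
  have "\<exists>t. x < t \<and> t < x + h \<and> D k (x + h) =
      (\<Sum>m<p. (D (k + m) x / fact m) * (x + h - x) ^ m) + (D (k + p) t / fact p) * (x + h - x) ^ p"
    by (rule Taylor_up[where diff = "\<lambda>m. D (k + m)" and a = x]) (use p h0 der in auto)
  then obtain t where t: "D k (x + h) =
      (\<Sum>m<p. (D (k + m) x / fact m) * h ^ m) + (D (k + p) t / fact p) * h ^ p" by auto
  \<comment> \<open>The remainder obeys the same bound as the Taylor terms, since at order \<open>N + 1\<close> the factor
    \<open>exp\<close> in the hypothesis on \<open>x\<close> equals 1.\<close>
  define E where "E = (\<lambda>j. A * M k * exp (real k - real (Suc N)) * ((exp 1 * \<mu> N * h) ^ j / fact j))"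
  have summand: "\<bar>(v / fact j) * h ^ j\<bar> \<le> E j"
    if v: "\<bar>v\<bar> \<le> A * M (k + j) * exp (real (k + j) - real (Suc N))" and j: "j \<le> p" for v j
  proof -
    have "\<bar>(v / fact j) * h ^ j\<bar> = \<bar>v\<bar> * (h ^ j / fact j)" using h by (simp add: abs_mult)
    also have "\<dots> \<le> (A * (M k * \<mu> N ^ j) * exp (real (k + j) - real (Suc N))) * (h ^ j / fact j)"
    proof (rule mult_right_mono)
      show "\<bar>v\<bar> \<le> A * (M k * \<mu> N ^ j) * exp (real (k + j) - real (Suc N))"
        using v Mgrow[OF j] A by (elim order_trans) (intro mult_right_mono mult_left_mono, auto)
    qed (use h in auto)
    also have "exp (real (k + j) - real (Suc N)) = exp (real k - real (Suc N)) * exp 1 ^ j"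
      by (simp add: exp_of_nat_mult[symmetric] exp_add[symmetric] algebra_simps)
    finally show ?thesis by (simp add: E_def power_mult_distrib mult_ac)
  qed
  have "\<bar>D k (x + h)\<bar> \<le> \<bar>\<Sum>m<p. (D (k + m) x / fact m) * h ^ m\<bar> + \<bar>(D (k + p) t / fact p) * h ^ p\<bar>"
    unfolding t by (rule abs_triangle_ineq)
  also have "\<dots> \<le> (\<Sum>m<p. E m) + E p"
  proof (rule add_mono)
    show "\<bar>\<Sum>m<p. (D (k + m) x / fact m) * h ^ m\<bar> \<le> (\<Sum>m<p. E m)"
    proof (rule order_trans[OF sum_abs], rule sum_mono)
      fix m assume "m \<in> {..<p}"
      then show "\<bar>(D (k + m) x / fact m) * h ^ m\<bar> \<le> E m"
        using x[of "k + m"] by (intro summand) (auto simp: M_def)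
    qed
    show "\<bar>(D (k + p) t / fact p) * h ^ p\<bar> \<le> E p"
      by (rule summand) (use bnd[of "k + p" t] p in \<open>auto simp: M_def\<close>)
  qed
  also have "\<dots> = (\<Sum>m\<le>p. E m)" by (simp add: lessThan_Suc_atMost[symmetric])
  also have "\<dots> = A * M k * exp (real k - real (Suc N)) * (\<Sum>m\<le>p. (exp 1 * \<mu> N * h) ^ m / fact m)"
    by (simp add: E_def sum_distrib_left)
  also have "\<dots> \<le> A * M k * exp (real k - real (Suc N)) * exp 1"
  proof (intro mult_left_mono)
    have y: "0 \<le> exp 1 * \<mu> N * h" "exp 1 * \<mu> N * h \<le> 1"
      using h pos[of N] by (auto simp: field_simps)
    have "(\<Sum>m\<le>p. (exp 1 * \<mu> N * h) ^ m / fact m) \<le> exp (exp 1 * \<mu> N * h)"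
      using y(1) by (rule exp_partial_sum_le) simp
    also have "\<dots> \<le> exp 1" using y by simp
    finally show "(\<Sum>m\<le>p. (exp 1 * \<mu> N * h) ^ m / fact m) \<le> exp 1" .
  qed (use A less_imp_le[OF Mpos] in auto)
  also have "\<dots> = A * M k * exp (real k - real N)" by (simp add: exp_add[symmetric] mult.assoc)
  finally show ?thesis by (simp add: M_def)
qed

text \<open>
The quasi-analyticity half of the Denjoy--Carleman theorem.  At the flat point 0 Bang's quantity is
below every level; by the previous lemma it needs length at least \<open>1 / (e \<mu>\<^sub>N)\<close> to rise from level
\<open>N + 1\<close> to level \<open>N\<close>.  Starting from a very high level, the lengths add up beyond any bound
before a fixed level \<open>N\<close> is reached, because the series of reciprocals diverges.
\<close>

theorem denjoy_carleman_bang: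
  fixes D :: "nat \<Rightarrow> real \<Rightarrow> real" and \<mu> :: "nat \<Rightarrow> real"
  assumes der: "\<And>k t. (D k has_real_derivative D (Suc k) t) (at t)"
    and bnd: "\<And>k t. \<bar>D k t\<bar> \<le> A * (\<Prod>j<k. \<mu> j)"
    and pos: "\<And>j. 0 < \<mu> j" and mono: "\<And>i j. i \<le> j \<Longrightarrow> \<mu> i \<le> \<mu> j"
    and div: "\<not> summable (\<lambda>j. 1 / \<mu> j)"
    and flat: "\<And>k. D k 0 = 0" and t: "0 \<le> t"
  shows "D 0 t = 0"
proof -
  have A: "0 \<le> A" using bnd[of 0 0] by simp
  let ?h = "\<lambda>j. 1 / (exp 1 * \<mu> j)"
  have hpos: "0 < ?h j" for j using pos by simp
  \<comment> \<open>Starting at level \<open>N + d\<close> at the point 0, level \<open>N\<close> is not exceeded within the sum of the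
    \<open>d\<close> lengths.\<close>
  have reach: "\<bar>D k y\<bar> \<le> A * (\<Prod>j<k. \<mu> j) * exp (real k - real N)"
    if "0 \<le> y" "y \<le> (\<Sum>j=N..<N+d. ?h j)" for d N k y
    using that
  proof (induction d arbitrary: N k y)
    case 0
    then have "y = 0" by simp
    moreover have "0 \<le> (\<Prod>j<k. \<mu> j)" by (intro prod_nonneg less_imp_le pos) 
    ultimately show ?case using flat A by simp
  next
    case (Suc d)
    define x where "x = max 0 (y - ?h N)"
    have "(\<Sum>j=N..<N+Suc d. ?h j) = ?h N + (\<Sum>j=Suc N..<Suc N+d. ?h j)"
      by (subst sum.atLeast_Suc_lessThan) auto
    moreover have "0 \<le> (\<Sum>j=Suc N..<Suc N+d. ?h j)" by (intro sum_nonneg less_imp_le hpos)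
    ultimately have x: "0 \<le> x" "x \<le> (\<Sum>j=Suc N..<Suc N+d. ?h j)" "0 \<le> y - x" "y - x \<le> ?h N"
      using Suc.prems less_imp_le[OF hpos, of N] by (auto simp: x_def)
    have "\<bar>D k (x + (y - x))\<bar> \<le> A * (\<Prod>j<k. \<mu> j) * exp (real k - real N)"
      by (rule bang_step[OF der bnd pos mono A Suc.IH[OF x(1,2)] x(3,4)])
    then show ?case by simp
  qed
  have "\<bar>D 0 t\<bar> \<le> A * exp (- real N)" for N
  proof -
    have "\<exists>n. t < (\<Sum>j<n. ?h (j + N))"
    proof (rule ccontr)
      assume "\<not> ?thesis"
      then have "summable (\<lambda>j. ?h (j + N))"
        by (intro summableI_nonneg_bounded[where x = t] less_imp_le[OF hpos]) (auto simp: not_less)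
      then have "summable ?h" by (subst (asm) summable_iff_shift)
      then have "summable (\<lambda>j. exp 1 * ?h j)" by (rule summable_mult)
      with div show False by simp
    qed
    then obtain d where "t < (\<Sum>j<d. ?h (j + N))" by blast
    also have "(\<Sum>j<d. ?h (j + N)) = (\<Sum>j=N..<N+d. ?h j)"
      using sum.shift_bounds_nat_ivl[of ?h 0 N d] by (simp add: lessThan_atLeast0 add.commute)
    finally show ?thesis using reach[of t N d 0] t by simp
  qed
  moreover have "(\<lambda>N. A * exp (- real N)) \<longlonglongrightarrow> A * 0"
    by (intro tendsto_mult tendsto_const filterlim_compose[OF exp_at_bot])
       (auto simp: filterlim_uminus_at_bot filterlim_real_sequentially)
  ultimately have "\<bar>D 0 t\<bar> \<le> A * 0" by (intro LIMSEQ_le_const) auto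
  then show ?thesis by simp
qed

section \<open>Weights associated with a decay rate\<close>

text \<open>
Ingham's choice of weights for a decay rate \<open>\<Theta>\<close>.  Evaluating \<open>\<Theta>\<close> at the fourth power makes the
weights bound the derivatives even when \<open>\<Theta>\<close> drops abruptly, provided that the coefficients also
decay like \<open>e\<close> to the power \<open>-\<surd>r\<close>; and it does not affect the divergence of the series.
\<close>

definition weight :: "(real \<Rightarrow> real) \<Rightarrow> nat \<Rightarrow> real" where
  "weight \<Theta> j = real (Suc j) / \<Theta> (real (Suc j) ^ 4)"

lemma prod_ratio_le_exp:
  fixes X :: real
  assumes "0 \<le> X" "a \<le> k"
  shows "(\<Prod>j=a..<k. X / real (Suc j)) \<le> exp X"
proof -
  have *: "(\<Prod>j=a..<a+p. X / real (Suc j)) \<le> X ^ p / fact p" for p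
  proof (induction p)
    case (Suc p)
    have "(\<Prod>j=a..<a+Suc p. X / real (Suc j)) = (\<Prod>j=a..<a+p. X / real (Suc j)) * (X / real (Suc (a + p)))"
      by simp
    also have "\<dots> \<le> (X ^ p / fact p) * (X / real (Suc p))"
      using Suc assms by (intro mult_mono divide_left_mono) (auto intro!: prod_nonneg)
    finally show ?case by (simp add: field_simps)
  qed simp
  have "X ^ p / fact p \<le> exp X" for p
    using exp_partial_sum_le[of X "{p}"] assms by simp
  with *[of "k - a"] assms show ?thesis by (auto intro: order_trans)
qed

lemma root_power_bound:
  fixes c :: real
  assumes "1 \<le> c"
  shows "\<exists>B\<ge>1. \<forall>q\<ge>1. q * ln (c * q ^ 4) \<le> B + q ^ 2"
proof -
  have "eventually (\<lambda>q. q * ln (c * q ^ 4) \<le> q ^ 2) at_top"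
    using assms by real_asymp
  then obtain Q where Q: "\<And>q. q \<ge> Q \<Longrightarrow> q * ln (c * q ^ 4) \<le> q ^ 2"
    by (auto simp: eventually_at_top_linorder)
  define R where "R = max Q 1"
  show ?thesis
  proof (intro exI[of _ "1 + R * ln (c * R ^ 4)"] conjI allI impI)
    have "1 \<le> c * R ^ 4" using assms one_le_power[of R 4] mult_mono[of 1 c 1 "R^4"] by (auto simp: R_def)
    then have "0 \<le> ln (c * R ^ 4)" by simp
    then have nn: "0 \<le> R * ln (c * R ^ 4)" by (auto simp: R_def)
    then show "1 \<le> 1 + R * ln (c * R ^ 4)" by simp
    fix q :: real assume q: "1 \<le> q"
    show "q * ln (c * q ^ 4) \<le> 1 + R * ln (c * R ^ 4) + q ^ 2"
    proof (cases "Q \<le> q")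
      case True
      show ?thesis using Q[OF True] nn by linarith
    next
      case False
      then have qR: "q \<le> R" by (simp add: R_def)
      have "1 \<le> c * q ^ 4" using assms q one_le_power[of q 4] mult_mono[of 1 c 1 "q^4"] by auto
      moreover have "c * q ^ 4 \<le> c * R ^ 4" using assms q qR by (intro mult_left_mono power_mono) auto
      ultimately have "q * ln (c * q ^ 4) \<le> R * ln (c * R ^ 4)"
        using q qR by (intro mult_mono) auto
      moreover have "0 \<le> q ^ 2" by simp
      ultimately show ?thesis by linarith
    qed
  qed
qed

text \<open>
The quotient of \<open>r\<^sup>k\<close> by the product of weights is a product of factors
\<open>r \<Theta>((j+1)\<^sup>4) / (j+1)\<close>.  Those with \<open>(j+1)\<^sup>4 \<ge> r\<close> are at most \<open>r \<Theta>(r) / (j+1)\<close> and contribute at most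
\<open>exp (r \<Theta>(r))\<close>, by the exponential series.  The others number at most the fourth root of \<open>r\<close>,
and each is at most a constant times \<open>r\<close>, so that they contribute only \<open>exp (\<surd>r)\<close> up to a constant.
\<close>

lemma power_le_weights:
  fixes \<Theta> :: "real \<Rightarrow> real"
  assumes pos: "\<And>r. 1 \<le> r \<Longrightarrow> 0 < \<Theta> r"
    and dec: "\<And>r s. 1 \<le> r \<Longrightarrow> r \<le> s \<Longrightarrow> \<Theta> s \<le> \<Theta> r"
  shows "\<exists>B\<ge>1. \<forall>k r. 1 \<le> r \<longrightarrow> r ^ k \<le> B * (\<Prod>j<k. weight \<Theta> j) * exp (\<Theta> r * r + sqrt r)"
proof -
  define c where "c = max 1 (\<Theta> 1)"
  have c: "1 \<le> c" "\<Theta> 1 \<le> c" by (auto simp: c_def)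
  obtain B where B: "B \<ge> 1" "\<And>q. q \<ge> 1 \<Longrightarrow> q * ln (c * q ^ 4) \<le> B + q ^ 2"
    using root_power_bound[OF c(1)] by blast
  have wpos: "0 < weight \<Theta> j" for j
    unfolding weight_def by (intro divide_pos_pos pos one_le_power) auto
  have main: "(\<Prod>j<k. r / weight \<Theta> j) \<le> exp B * exp (\<Theta> r * r + sqrt r)" if r: "1 \<le> r" for k r
  proof -
    define q where "q = sqrt (sqrt r)"
    have q: "1 \<le> q" "q ^ 2 = sqrt r" "q ^ 4 = r"
    proof -
      show "1 \<le> q" "q ^ 2 = sqrt r" using r by (auto simp: q_def)
      then have "(q ^ 2) ^ 2 = r" using r by simp
      then show "q ^ 4 = r" by (simp flip: power_mult)
    qed
    define a where "a = min k (nat \<lfloor>q\<rfloor>)"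
    have ak: "a \<le> k" "real a \<le> q" using q(1) by (auto simp: a_def min_def) linarith+
    have "{..<k} = {..<a} \<union> {a..<k}" using ak by auto
    then have "(\<Prod>j<k. r / weight \<Theta> j) = (\<Prod>j<a. r / weight \<Theta> j) * (\<Prod>j=a..<k. r / weight \<Theta> j)"
      by (simp add: prod.union_disjoint ivl_disj_int)
    also have "\<dots> \<le> exp (B + q ^ 2) * exp (\<Theta> r * r)"
    proof (intro mult_mono)
      have cq: "1 \<le> c * q ^ 4" using c r mult_mono[of 1 c 1 r] by (simp add: q(3))
      have "(\<Prod>j<a. r / weight \<Theta> j) \<le> (\<Prod>j<a. c * q ^ 4)"
      proof (intro prod_mono conjI)
        fix j assume "j \<in> {..<a}"
        show "0 \<le> r / weight \<Theta> j" using wpos[of j] r by simp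
        have "\<Theta> (real (Suc j) ^ 4) \<le> c"
          using dec[of 1 "real (Suc j) ^ 4"] c one_le_power[of "real (Suc j)" 4] by auto
        then have "\<Theta> (real (Suc j) ^ 4) \<le> c * real (Suc j)"
          using c(1) mult_left_mono[of 1 "real (Suc j)" c] by linarith
        then have "\<Theta> (real (Suc j) ^ 4) / real (Suc j) \<le> c" by (simp add: divide_le_eq)
        then show "r / weight \<Theta> j \<le> c * q ^ 4"
          using r mult_left_mono[of "\<Theta> (real (Suc j) ^ 4) / real (Suc j)" c r]
            by (simp add: weight_def q(3) mult.commute)
      qed
      also have "\<dots> = (c * q ^ 4) ^ a" by simp
      also have "\<dots> = exp (real a * ln (c * q ^ 4))"
        using cq by (simp add: exp_of_nat_mult)
      also have "\<dots> \<le> exp (q * ln (c * q ^ 4))"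
        using cq ak by (simp add: mult_right_mono)
      also have "\<dots> \<le> exp (B + q ^ 2)" using B(2)[OF q(1)] by simp
      finally show "(\<Prod>j<a. r / weight \<Theta> j) \<le> exp (B + q ^ 2)" .
      have "(\<Prod>j=a..<k. r / weight \<Theta> j) \<le> (\<Prod>j=a..<k. (\<Theta> r * r) / real (Suc j))"
      proof (intro prod_mono conjI)
        fix j assume j: "j \<in> {a..<k}"
        show "0 \<le> r / weight \<Theta> j" using wpos[of j] r by simp
        have "q < real (Suc j)" using j q(1) by (auto simp: a_def min_def split: if_splits) linarith+
        then have "q ^ 4 \<le> real (Suc j) ^ 4" using q(1) by (intro power_mono) auto
        then have "\<Theta> (real (Suc j) ^ 4) \<le> \<Theta> r" using dec[of r "real (Suc j) ^ 4"] r by (simp add: q(3))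
        then show "r / weight \<Theta> j \<le> (\<Theta> r * r) / real (Suc j)"
          using r by (simp add: weight_def divide_right_mono mult_left_mono mult.commute)
      qed
      also have "\<dots> \<le> exp (\<Theta> r * r)"
        using pos[OF r] r ak by (intro prod_ratio_le_exp) auto
      finally show "(\<Prod>j=a..<k. r / weight \<Theta> j) \<le> exp (\<Theta> r * r)" .
    qed (use wpos r less_imp_le in \<open>auto intro!: prod_nonneg divide_nonneg_nonneg\<close>)
    also have "\<dots> = exp B * exp (\<Theta> r * r + sqrt r)" by (simp add: q(2) exp_add)
    finally show ?thesis .
  qed
  show ?thesis
  proof (intro exI[of _ "exp B"] conjI allI impI)
    fix k :: nat and r :: real assume r: "1 \<le> r"
    have "(\<Prod>j<k. r / weight \<Theta> j) = r ^ k / (\<Prod>j<k. weight \<Theta> j)" by (simp add: prod_dividef)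
    moreover have "0 < (\<Prod>j<k. weight \<Theta> j)" using wpos by (intro prod_pos) auto
    ultimately show "r ^ k \<le> exp B * (\<Prod>j<k. weight \<Theta> j) * exp (\<Theta> r * r + sqrt r)"
      using main[OF r, of k] by (simp add: pos_divide_le_eq mult_ac)
  qed (use B in simp)
qed

lemma weight_mono:
  assumes pos: "\<And>r. 1 \<le> r \<Longrightarrow> 0 < \<Theta> r"
    and dec: "\<And>r s. 1 \<le> r \<Longrightarrow> r \<le> s \<Longrightarrow> \<Theta> s \<le> \<Theta> r"
    and "i \<le> j"
  shows "weight \<Theta> i \<le> weight \<Theta> j"
  unfolding weight_def using \<open>i \<le> j\<close> pos dec
  by (intro frac_le dec one_le_power power_mono pos) auto

text \<open>
A condensation argument: between consecutive fourth powers the terms \<open>\<Theta>(m) / m\<close> add up to at most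
\<open>15 \<Theta>(j\<^sup>4) / j\<close>, where 15 bounds \<open>((j+1)\<^sup>4 - j\<^sup>4) / j\<^sup>3\<close>.
\<close>

lemma not_summable_inverse_weight:
  assumes pos: "\<And>r. 1 \<le> r \<Longrightarrow> 0 < \<Theta> r"
    and dec: "\<And>r s. 1 \<le> r \<Longrightarrow> r \<le> s \<Longrightarrow> \<Theta> s \<le> \<Theta> r"
    and div: "\<not> summable (\<lambda>k. \<Theta> (real (Suc k)) / real (Suc k))"
  shows "\<not> summable (\<lambda>j. 1 / weight \<Theta> j)"
proof
  assume s: "summable (\<lambda>j. 1 / weight \<Theta> j)"
  let ?f = "\<lambda>k. \<Theta> (real (Suc k)) / real (Suc k)"
  let ?g = "\<lambda>j. 1 / weight \<Theta> j"
  have fpos: "0 \<le> ?f k" for k using pos[of "real (Suc k)"] by simp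
  have gpos: "0 \<le> ?g k" for k
    unfolding weight_def using pos[of "real (Suc k) ^ 4"] one_le_power[of "real (Suc k)" 4] by simp
  have block: "(\<Sum>k = Suc J ^ 4 - 1..<Suc (Suc J) ^ 4 - 1. ?f k) \<le> 15 * ?g J" for J
  proof -
    have "(\<Sum>k = Suc J ^ 4 - 1..<Suc (Suc J) ^ 4 - 1. ?f k)
        \<le> (\<Sum>k = Suc J ^ 4 - 1..<Suc (Suc J) ^ 4 - 1. \<Theta> (real (Suc J) ^ 4) / real (Suc J) ^ 4)"
    proof (intro sum_mono frac_le)
      fix k assume "k \<in> {Suc J ^ 4 - 1..<Suc (Suc J) ^ 4 - 1}"
      then have "Suc J ^ 4 \<le> Suc k" by auto
      then have "real (Suc J ^ 4) \<le> real (Suc k)" by (rule of_nat_mono)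
      then show *: "real (Suc J) ^ 4 \<le> real (Suc k)" by simp
      show "\<Theta> (real (Suc k)) \<le> \<Theta> (real (Suc J) ^ 4)"
        by (intro dec * one_le_power) auto
      show "0 \<le> \<Theta> (real (Suc J) ^ 4)"
        by (rule less_imp_le[OF pos[OF one_le_power]]) auto
      show "0 < real (Suc J) ^ 4" by (intro zero_less_power) simp
    qed
    also have "\<dots> = (real (Suc (Suc J)) ^ 4 - real (Suc J) ^ 4) * (\<Theta> (real (Suc J) ^ 4) / real (Suc J) ^ 4)"
    proof -
      have "real (card {a - 1..<b - 1}) = real b - real a" if "1 \<le> a" "a \<le> b" for a b :: nat
        using that by (simp add: of_nat_diff)
      from this[of "Suc J ^ 4" "Suc (Suc J) ^ 4"]
      have "real (card {Suc J ^ 4 - 1..<Suc (Suc J) ^ 4 - 1}) = real (Suc (Suc J)) ^ 4 - real (Suc J) ^ 4"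
        using one_le_power[of "Suc J" 4] power_mono[of "Suc J" "Suc (Suc J)" 4] by (simp only: of_nat_power)
      then show ?thesis by (simp only: sum_constant)
    qed
    also have "\<dots>
        \<le> (15 * real (Suc J) ^ 3) * (\<Theta> (real (Suc J) ^ 4) / real (Suc J) ^ 4)"
    proof (rule mult_right_mono)
      have "(x + 1) ^ 4 - x ^ 4 \<le> 15 * x ^ 3" if x: "1 \<le> x" for x :: real
      proof -
        have "x ^ 2 \<le> x ^ 3" "x ^ 1 \<le> x ^ 3" "x ^ 0 \<le> x ^ 3" using x by (intro power_increasing; simp)+
        moreover have "(x + 1) ^ 4 - x ^ 4 = 4 * x ^ 3 + 6 * x ^ 2 + 4 * x + 1"
          by (simp add: algebra_simps power4_eq_xxxx power3_eq_cube power2_eq_square)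
        ultimately show ?thesis by simp
      qed
      from this[of "real (Suc J)"] show "real (Suc (Suc J)) ^ 4 - real (Suc J) ^ 4 \<le> 15 * real (Suc J) ^ 3"
        by (simp add: add_ac)
      have "0 \<le> \<Theta> (real (Suc J) ^ 4)"
        by (rule less_imp_le[OF pos[OF one_le_power]]) auto
      then show "0 \<le> \<Theta> (real (Suc J) ^ 4) / real (Suc J) ^ 4" by simp
    qed
    also have "\<dots> = 15 * ?g J"
    proof -
      have "15 * x ^ 3 * (T / x ^ 4) = 15 * (T / x)" if "x > 0" for x T :: real
        using that by (simp add: field_simps power3_eq_cube power4_eq_xxxx)
      from this[of "real (Suc J)"] show ?thesis unfolding weight_def by simp
    qed
    finally show ?thesis .
  qed
  have tot: "(\<Sum>k<Suc J ^ 4 - 1. ?f k) \<le> 15 * (\<Sum>j<J. ?g j)" for J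
  proof (induction J)
    case (Suc J)
    have split: "(\<Sum>k<b. ?f k) = (\<Sum>k<a. ?f k) + (\<Sum>k=a..<b. ?f k)" if "a \<le> b" for a b :: nat
      using that by (simp add: lessThan_atLeast0 sum.atLeastLessThan_concat)
    have "(\<Sum>k<Suc (Suc J) ^ 4 - 1. ?f k)
       = (\<Sum>k<Suc J ^ 4 - 1. ?f k) + (\<Sum>k = Suc J ^ 4 - 1..<Suc (Suc J) ^ 4 - 1. ?f k)"
      by (rule split, rule diff_le_mono, rule power_mono) auto
    also have "\<dots> \<le> 15 * (\<Sum>j<J. ?g j) + 15 * ?g J" by (intro add_mono Suc.IH block)
    finally show ?case by (simp add: algebra_simps)
  qed simp
  have "summable ?f"
  proof (rule summableI_nonneg_bounded[OF fpos])
    fix n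
    have "n \<le> Suc n ^ 4 - 1" using self_le_power[of "Suc n" 4] by simp
    then have "(\<Sum>k<n. ?f k) \<le> (\<Sum>k<Suc n ^ 4 - 1. ?f k)" by (intro sum_mono2 fpos) auto
    also have "\<dots> \<le> 15 * (\<Sum>j<n. ?g j)" by (rule tot)
    also have "\<dots> \<le> 15 * suminf ?g" by (intro mult_left_mono sum_le_suminf s gpos) auto
    finally show "(\<Sum>k<n. ?f k) \<le> 15 * suminf ?g" .
  qed
  with div show False by simp
qed

section \<open>Characters and the lattice\<close>

definition echar :: "int ^ 'n \<Rightarrow> real ^ 'n::finite \<Rightarrow> complex" where
  "echar m x = cis (2 * pi * (lattice_vec m \<bullet> x))"

lemma lattice_vec_add: "lattice_vec (m + k) = lattice_vec m + lattice_vec k"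
  and lattice_vec_minus: "lattice_vec (- m) = - lattice_vec m"
  and lattice_vec_zero [simp]: "lattice_vec 0 = 0"
  by (simp_all add: lattice_vec_def vec_eq_iff)

lemma lattice_vec_eq_0_iff [simp]: "lattice_vec m = 0 \<longleftrightarrow> m = 0"
  by (simp add: lattice_vec_def vec_eq_iff)

lemma norm_lattice_vec_ge_1:
  assumes "m \<noteq> 0" shows "1 \<le> norm (lattice_vec m)"
proof -
  obtain i where "m $ i \<noteq> 0" using assms by (auto simp: vec_eq_iff)
  then have "1 \<le> \<bar>lattice_vec m $ i\<bar>" by (simp add: lattice_vec_def)
  also have "\<dots> \<le> norm (lattice_vec m)" by (rule component_le_norm_cart)
  finally show ?thesis .
qed

lemma norm_echar [simp]: "norm (echar m x) = 1"
  by (simp add: echar_def)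

lemma echar_0 [simp]: "echar 0 x = 1" "echar m 0 = 1"
  by (simp_all add: echar_def)

lemma echar_add_left: "echar (m + k) x = echar m x * echar k x"
  and echar_add: "echar m (x + y) = echar m x * echar m y"
  by (simp_all add: echar_def lattice_vec_add inner_add cis_mult algebra_simps)

lemma echar_minus: "echar (- m) x = echar m (- x)"
  by (simp add: echar_def lattice_vec_minus)

lemma cnj_echar: "cnj (echar m x) = echar (- m) x"
  by (simp add: echar_def lattice_vec_minus cis_cnj)

lemma continuous_on_echar [continuous_intros]:
  "continuous_on S f \<Longrightarrow> continuous_on S (\<lambda>x. echar m (f x))"
  unfolding echar_def by (intro continuous_intros)

lemma borel_measurable_echar [measurable]: "echar m \<in> borel_measurable borel"
  by (intro borel_measurable_continuous_onI continuous_intros)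

lemma fourier_coeff_eq:
  "fourier_coeff f m = (LINT x | lebesgue_on unit_cube. f (torus_point x) * echar (- m) x)"
  unfolding fourier_coeff_def echar_def lattice_vec_minus cis_conv_exp
  by (intro Bochner_Integration.integral_cong refl) (simp add: mult_ac)

lemma sets_unit_cube [measurable]: "unit_cube \<in> sets borel" "unit_cube \<in> sets lebesgue"
  by (auto simp: unit_cube_def)

lemma mem_unit_cube: "x \<in> unit_cube \<longleftrightarrow> (\<forall>i. 0 \<le> x $ i \<and> x $ i \<le> 1)"
  by (simp add: unit_cube_def mem_box_cart)

lemma integral_cube_lborel:
  fixes f :: "real ^ 'n::finite \<Rightarrow> 'b::{banach, second_countable_topology}"
  assumes [measurable]: "f \<in> borel_measurable borel"
  shows "(LINT x | lebesgue_on unit_cube. f x) = (LINT x | lborel. indicator unit_cube x *\<^sub>R f x)"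
  by (subst integral_restrict_space) (auto simp: integral_completion)

lemma finite_measure_cube: "finite_measure (lebesgue_on (unit_cube :: (real ^ 'n::finite) set))"
  by standard (simp add: emeasure_restrict_space unit_cube_def emeasure_lborel_cbox_eq)

lemma integral_cis:
  fixes a :: real
  assumes a: "a \<noteq> 0"
  shows "(LINT t | lborel. indicator {0..1} t *\<^sub>R cis (a * t)) = (cis a - 1) / (\<i> * of_real a)"
proof -
  let ?c = "\<i> * of_real a"
  define F where "F = (\<lambda>t. cis (a * t) / ?c)"
  have "(LINT t | lborel. indicator {0..1} t *\<^sub>R cis (a * t)) = F 1 - F 0"
  proof (rule integral_FTC_Icc)
    fix x :: real
    have F: "F = (\<lambda>t. exp (?c * of_real t) / ?c)"
      by (simp add: F_def cis_conv_exp mult_ac)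
    have "((\<lambda>z. exp (?c * z) / ?c) has_field_derivative exp (?c * of_real x)) (at (of_real x))"
      using a by (auto intro!: derivative_eq_intros)
    from has_vector_derivative_real_field[OF this]
    show "(F has_vector_derivative cis (a * x)) (at x within {0..1})"
      by (simp add: F cis_conv_exp mult_ac)
  qed (auto intro!: continuous_intros)
  then show ?thesis by (simp add: F_def diff_divide_distrib)
qed

lemma integral_cis_period:
  fixes k :: int
  shows "(LINT t | lborel. indicator {0..1} t *\<^sub>R cis (2 * pi * of_int k * t)) = (if k = 0 then 1 else 0)"
  using integral_cis[of "2 * pi * of_int k"] by (cases "k = 0") auto

lemma cis_sum: "finite A \<Longrightarrow> cis (sum f A) = (\<Prod>a\<in>A. cis (f a))"
  by (induction A rule: finite_induct) (simp_all flip: cis_mult)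

lemma integral_echar:
  fixes m :: "int ^ 'n::finite"
  shows "(LINT x | lebesgue_on unit_cube. echar m x) = (if m = 0 then 1 else 0)"
proof -
  let ?B = "Basis :: (real ^ 'n) set"
  interpret product_sigma_finite "\<lambda>_. lborel :: real measure" ..
  define g where "g = (\<lambda>(b :: real ^ 'n) (t :: real). indicator {0..1} t *\<^sub>R cis (2 * pi * (lattice_vec m \<bullet> b) * t))"
  have int: "\<exists>k::int. lattice_vec m \<bullet> b = of_int k" if "b \<in> ?B" for b
    using that by (auto simp: Basis_vec_def inner_axis lattice_vec_def)
  have prod: "indicator unit_cube x *\<^sub>R echar m x = (\<Prod>b\<in>?B. g b (x \<bullet> b))" for x
  proof -
    have "vec 1 \<bullet> b = (1::real)" if "b \<in> ?B" for b
      using that by (auto simp: Basis_vec_def inner_axis)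
    then have "indicator unit_cube x = (\<Prod>b\<in>?B. indicator {0..1} (x \<bullet> b) :: real)"
      unfolding unit_cube_def by (auto simp: indicator_def mem_box prod_eq_1_iff intro!: prod.neutral split: if_splits)
    moreover have "echar m x = (\<Prod>b\<in>?B. cis (2 * pi * (lattice_vec m \<bullet> b) * (x \<bullet> b)))"
      unfolding echar_def euclidean_inner[of "lattice_vec m" x] sum_distrib_left
      by (subst cis_sum) (auto simp: mult_ac)
    ultimately show ?thesis by (simp add: g_def prod.distrib scaleR_conv_of_real)
  qed
  have gm [measurable]: "g b \<in> borel_measurable borel" for b
    unfolding g_def by (intro borel_measurable_scaleR borel_measurable_indicator borel_measurable_continuous_onI continuous_intros) auto
  have "(LINT x | lebesgue_on unit_cube. echar m x) = (LINT x | lborel. (\<Prod>b\<in>?B. g b (x \<bullet> b)))"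
    by (subst integral_cube_lborel) (auto simp: prod)
  also have "\<dots> = (LINT y | (\<Pi>\<^sub>M b\<in>?B. lborel). (\<Prod>b\<in>?B. g b ((\<Sum>b\<in>?B. y b *\<^sub>R b) \<bullet> b)))"
    by (subst lborel_eq, subst integral_distr) auto
  also have "\<dots> = (LINT y | (\<Pi>\<^sub>M b\<in>?B. lborel). (\<Prod>b\<in>?B. g b (y b)))"
    by (intro Bochner_Integration.integral_cong refl prod.cong) auto
  also have "\<dots> = (\<Prod>b\<in>?B. LINT t | lborel. g b t)"
  proof (rule product_integral_prod)
    fix b show "integrable lborel (g b)"
      unfolding g_def by (intro borel_integrable_compact) (auto intro!: continuous_intros)
  qed auto
  also have "\<dots> = (\<Prod>b\<in>?B. if lattice_vec m \<bullet> b = 0 then 1 else 0)"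
  proof (intro prod.cong refl)
    fix b assume "b \<in> ?B"
    then obtain k where "lattice_vec m \<bullet> b = of_int k" using int by blast
    then show "(LINT t | lborel. g b t) = (if lattice_vec m \<bullet> b = 0 then 1 else 0)"
      using integral_cis_period[of k] by (simp add: g_def)
  qed
  also have "\<dots> = (if m = 0 then 1 else 0)"
    using euclidean_eq_iff[of "lattice_vec m" 0] by (auto intro!: prod.neutral)
  finally show ?thesis .
qed

definition lattice_enum :: "nat \<Rightarrow> int ^ 'n::finite" where
  "lattice_enum = from_nat_into UNIV"

lemma bij_lattice_enum: "bij (lattice_enum :: nat \<Rightarrow> int ^ 'n::finite)"
  unfolding lattice_enum_def by (intro bij_betw_from_nat_into) (auto simp: infinite_UNIV_vec infinite_UNIV_int)

text \<open>
The norm of a vector dominates each coordinate, so \<open>\<surd>\<bar>m\<bar>\<close> is at least the average of the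
\<open>\<surd>\<bar>m\<^sub>i\<bar>\<close>.  Hence the terms are bounded by a product of functions of one coordinate each, and a sum
over a box of lattice points factors into one-dimensional sums.
\<close>

lemma summable_lattice:
  "summable (\<lambda>k. exp (- sqrt (norm (lattice_vec (lattice_enum k :: int ^ 'n::finite)))))"
proof -
  define n where "n = real CARD('n)"
  have n: "0 < n" by (simp add: n_def)
  define g where "g = (\<lambda>j::nat. exp (- (sqrt (real j) / n)))"
  define h where "h = (\<lambda>j::int. exp (- (sqrt \<bar>of_int j\<bar> / n)))"
  have "g \<in> O(\<lambda>j. 1 / real j ^ 2)" unfolding g_def using n by real_asymp
  then have sg: "summable g"
    by (rule summable_comparison_test_bigo[rotated]) (use inverse_power_summable[of 2, where 'a=real] in \<open>simp add: field_simps\<close>)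
  have h1: "(\<Sum>j\<in>{- int N..int N}. h j) \<le> 2 * suminf g" for N
  proof -
    have "(\<Sum>j\<in>{- int N..int N}. h j) \<le> (\<Sum>j\<in>int ` {..N} \<union> (\<lambda>j. - int j) ` {..N}. h j)"
    proof (intro sum_mono2)
      show "{- int N..int N} \<subseteq> int ` {..N} \<union> (\<lambda>j. - int j) ` {..N}"
      proof
        fix j assume "j \<in> {- int N..int N}"
        then have "(0 \<le> j \<and> j = int (nat j) \<and> nat j \<le> N) \<or> (j = - int (nat (- j)) \<and> nat (- j) \<le> N)" by auto
        then show "j \<in> int ` {..N} \<union> (\<lambda>j. - int j) ` {..N}" by blast
      qed
    qed (auto simp: h_def)
    also have "\<dots> \<le> (\<Sum>j\<in>int ` {..N}. h j) + (\<Sum>j\<in>(\<lambda>j. - int j) ` {..N}. h j)"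
      by (subst sum_Un) (auto intro!: sum_nonneg simp: h_def)
    also have "\<dots> = 2 * (\<Sum>j\<le>N. g j)"
      by (subst (1 2) sum.reindex) (auto simp: inj_on_def h_def g_def)
    also have "\<dots> \<le> 2 * suminf g"
      by (intro mult_left_mono sum_le_suminf sg) (auto simp: g_def)
    finally show ?thesis .
  qed
  show ?thesis
  proof (rule summableI_nonneg_bounded)
    fix K :: nat
    let ?A = "(lattice_enum :: nat \<Rightarrow> int ^ 'n) ` {..<K}"
    have fin: "finite ?A" by simp
    obtain N :: nat where N: "\<And>m i. m \<in> ?A \<Longrightarrow> \<bar>m $ i\<bar> \<le> int N"
    proof -
      let ?T = "\<Union>m\<in>?A. range (\<lambda>i. nat \<bar>m $ i\<bar>)"
      have "finite ?T" by auto
      then have "\<And>m i. m \<in> ?A \<Longrightarrow> nat \<bar>m $ i\<bar> \<le> Max ?T" by (intro Max_ge) auto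
      then show ?thesis by (intro that[of "Max ?T"]) (meson nat_le_iff)
    qed
    have "(\<Sum>k<K. exp (- sqrt (norm (lattice_vec (lattice_enum k :: int ^ 'n))))) = (\<Sum>m\<in>?A. exp (- sqrt (norm (lattice_vec m))))"
      using bij_lattice_enum by (subst sum.reindex) (auto simp: bij_def intro: inj_on_subset)
    also have "\<dots> \<le> (\<Sum>m\<in>?A. \<Prod>i\<in>UNIV. h (m $ i))"
    proof (rule sum_mono)
      fix m :: "int ^ 'n"
      have "(\<Sum>i\<in>(UNIV :: 'n set). sqrt \<bar>of_int (m $ i)\<bar> / n) \<le> (\<Sum>i\<in>(UNIV :: 'n set). sqrt (norm (lattice_vec m)) / n)"
      proof (intro sum_mono divide_right_mono)
        fix i show "sqrt \<bar>of_int (m $ i)\<bar> \<le> sqrt (norm (lattice_vec m))"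
          using component_le_norm_cart[of "lattice_vec m" i] by (simp add: lattice_vec_def)
      qed (use n in auto)
      also have "\<dots> = sqrt (norm (lattice_vec m))" by (simp add: n_def)
      finally show "exp (- sqrt (norm (lattice_vec m))) \<le> (\<Prod>i\<in>UNIV. h (m $ i))"
        unfolding h_def by (subst exp_sum[symmetric]) (auto simp: sum_negf)
    qed
    also have "\<dots> = (\<Sum>f\<in>(\<lambda>m. ($) m) ` ?A. \<Prod>i\<in>UNIV. h (f i))"
      by (subst sum.reindex) (auto simp: inj_on_def vec_eq_iff)
    also have "\<dots> \<le> (\<Sum>f\<in>PiE UNIV (\<lambda>_::'n. {- int N..int N}). \<Prod>i\<in>UNIV. h (f i))"
    proof (rule sum_mono2)
      show "(\<lambda>m. ($) m) ` ?A \<subseteq> PiE UNIV (\<lambda>_. {- int N..int N})"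
        using N by (force simp: abs_le_iff)
    qed (auto intro!: prod_nonneg finite_PiE simp: h_def)
    also have "\<dots> = (\<Prod>i\<in>(UNIV :: 'n set). \<Sum>j\<in>{- int N..int N}. h j)"
      by (subst prod_sum_PiE) auto
    also have "\<dots> \<le> (\<Prod>i\<in>(UNIV :: 'n set). 2 * suminf g)"
      by (intro prod_mono conjI h1 sum_nonneg) (auto simp: h_def)
    finally show "(\<Sum>k<K. exp (- sqrt (norm (lattice_vec (lattice_enum k :: int ^ 'n))))) \<le> (\<Prod>i\<in>(UNIV :: 'n set). 2 * suminf g)" .
  qed simp
qed

section \<open>Uniqueness of Fourier coefficients on the torus\<close>

lemma cube_bounded:
  fixes g :: "real ^ 'n::finite \<Rightarrow> complex"
  assumes "continuous_on UNIV g"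
  obtains B where "0 < B" "\<And>x. x \<in> unit_cube \<Longrightarrow> norm (g x) \<le> B"
proof -
  have "compact (g ` unit_cube)"
    unfolding unit_cube_def using assms by (intro compact_continuous_image) (auto intro: continuous_on_subset)
  then have "bounded (g ` unit_cube)" by (rule compact_imp_bounded)
  then show ?thesis using that by (auto simp: bounded_pos)
qed

lemma measurable_lebesgue_on_continuous:
  fixes g :: "real ^ 'n::finite \<Rightarrow> 'b::{topological_space}"
  assumes "continuous_on UNIV g"
  shows "g \<in> borel_measurable (lebesgue_on S)"
  using borel_measurable_continuous_onI[OF assms]
  by (intro measurable_restrict_space1 measurable_completion) simp

lemma integrable_cube_mult:
  fixes F g :: "real ^ 'n::finite \<Rightarrow> complex"
  assumes F: "integrable (lebesgue_on unit_cube) F" and g: "continuous_on UNIV g"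
  shows "integrable (lebesgue_on unit_cube) (\<lambda>x. F x * g x)"
proof -
  obtain B where B: "0 < B" "\<And>x. x \<in> unit_cube \<Longrightarrow> norm (g x) \<le> B" using cube_bounded[OF g] by blast
  note [measurable] = measurable_lebesgue_on_continuous[OF g] borel_measurable_integrable[OF F]
  show ?thesis
  proof (rule Bochner_Integration.integrable_bound)
    show "integrable (lebesgue_on unit_cube) (\<lambda>x. B * norm (F x))" using F by auto
    show "AE x in lebesgue_on unit_cube. norm (F x * g x) \<le> norm (B * norm (F x))"
    proof (rule AE_I2)
      fix x :: "real ^ 'n" assume "x \<in> space (lebesgue_on unit_cube)"
      then have "norm (F x) * norm (g x) \<le> norm (F x) * B" using B by (intro mult_left_mono) auto
      then show "norm (F x * g x) \<le> norm (B * norm (F x))" using B by (simp add: norm_mult mult.commute)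
    qed
  qed measurable
qed

lemma continuous_on_torus_point: "continuous_on S torus_point"
  unfolding torus_point_def by (intro continuous_intros)

lemma torus_point_in_torus: "torus_point x \<in> torus"
  by (simp add: torus_def torus_point_def)

lemma compact_torus: "compact (torus :: (complex ^ 'n::finite) set)"
proof -
  have "torus = torus_point ` (unit_cube :: (real ^ 'n) set)"
    unfolding torus_eq by (auto simp: unit_cube_def mem_box_cart)
  moreover have "compact (torus_point ` (unit_cube :: (real ^ 'n) set))"
    by (intro compact_continuous_image continuous_on_torus_point) (simp add: unit_cube_def)
  ultimately show ?thesis by simp
qed

lemma torus_point_inner_Basis:
  fixes b :: "complex ^ 'n::finite"
  assumes "b \<in> Basis"
  obtains m :: "int ^ 'n" and c d :: complex
  where "\<And>x. complex_of_real (torus_point x \<bullet> b) = c * echar m x + d * echar (- m) x"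
proof -
  obtain i and w :: complex where b: "b = axis i w" using assms by (auto simp: Basis_vec_def)
  have "lattice_vec (axis i 1) \<bullet> x = x $ i" for x :: "real ^ 'n"
    by (simp add: lattice_vec_def inner_vec_def axis_def if_distrib[of "\<lambda>t. t * _"] if_distrib[of real_of_int] cong: if_cong)
  then have e: "torus_point x $ i = echar (axis i 1) x" "cnj (torus_point x $ i) = echar (- axis i 1) x" for x :: "real ^ 'n"
    by (simp_all add: torus_point_def echar_def cis_conv_exp lattice_vec_minus exp_cnj mult_ac)
  have inner: "complex_of_real (z \<bullet> w) = (cnj w / 2) * z + (w / 2) * cnj z" for z
    by (simp add: complex_eq_iff inner_complex_def field_simps)
  show ?thesis
    by (rule that[of "cnj w / 2" "axis i 1" "w / 2"]) (simp only: b inner_axis inner e cnj_echar)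
qed

text \<open>
The class \<open>W\<close> of continuous multipliers \<open>u\<close> for which all Fourier coefficients of \<open>F u\<close> vanish is a vector space
stable under multiplication by characters.  The real and imaginary coordinates on the torus are
combinations of two characters, so \<open>W\<close> is stable under multiplication by polynomials in them, and
the Stone--Weierstrass theorem finishes the argument.
\<close>

lemma integral_against_continuous_eq_0:
  fixes F :: "real ^ 'n::finite \<Rightarrow> complex" and h :: "complex ^ 'n \<Rightarrow> real"
  assumes F: "integrable (lebesgue_on unit_cube) F"
    and zero: "\<And>m. (LINT x | lebesgue_on unit_cube. F x * echar m x) = 0"
    and h: "continuous_on torus h"
  shows "(LINT x | lebesgue_on unit_cube. F x * of_real (h (torus_point x))) = 0"
proof -
  define W where "W = (\<lambda>u :: real ^ 'n \<Rightarrow> complex. continuous_on UNIV u \<and>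
    (\<forall>m. (LINT x | lebesgue_on unit_cube. F x * (u x * echar m x)) = 0))"
  have int: "integrable (lebesgue_on unit_cube) (\<lambda>x. F x * (u x * echar m x))" if "W u" for u m
    by (intro integrable_cube_mult F) (use that in \<open>auto simp: W_def intro!: continuous_intros\<close>)
  have W_1: "W (\<lambda>x. 1)" using zero by (auto simp: W_def intro!: continuous_intros)
  have W_0: "W (\<lambda>x. 0)" by (auto simp: W_def intro!: continuous_intros)
  have W_add: "W (\<lambda>x. u x + v x)" if "W u" "W v" for u v
    using that int[OF that(1)] int[OF that(2)] unfolding W_def
    by (auto intro!: continuous_intros simp: distrib_left distrib_right)
  have W_sum: "W (\<lambda>x. \<Sum>a\<in>A. u a x)" if "finite A" "\<And>a. a \<in> A \<Longrightarrow> W (u a)" for A :: "(complex ^ 'n) set" and u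
    using that by (induction A rule: finite_induct) (auto intro: W_0 W_add)
  have W_scale: "W (\<lambda>x. c * u x)" if "W u" for u c
    using that unfolding W_def by (auto intro!: continuous_intros simp: mult.assoc mult.left_commute[of _ c])
  have W_echar: "W (\<lambda>x. echar k x * u x)" if "W u" for u k
  proof -
    have eq: "echar k x * u x * echar m x = u x * echar (m + k) x" for x m
      by (simp only: echar_add_left mult_ac)
    show ?thesis using that unfolding W_def eq by (auto intro!: continuous_intros)
  qed
  have W_poly: "\<forall>u. W u \<longrightarrow> W (\<lambda>x. of_real (p (torus_point x)) * u x)"
    if "real_polynomial_function p" for p :: "complex ^ 'n \<Rightarrow> real"
    using that
  proof (induction p rule: real_polynomial_function.induct)
    case (linear f)
    show ?case
    proof (intro allI impI)
      fix u assume u: "W u"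
      have "f (torus_point x) = (\<Sum>b\<in>Basis. (torus_point x \<bullet> b) * f b)" for x :: "real ^ 'n"
      proof -
        have "f (torus_point x) = f (\<Sum>b\<in>Basis. (torus_point x \<bullet> b) *\<^sub>R b)"
          by (simp only: euclidean_representation)
        also have "\<dots> = (\<Sum>b\<in>Basis. (torus_point x \<bullet> b) * f b)"
          using bounded_linear.linear[OF linear] by (simp add: linear_sum linear_scale)
        finally show ?thesis .
      qed
      then have eq: "(\<lambda>x. of_real (f (torus_point x)) * u x) =
          (\<lambda>x. \<Sum>b\<in>Basis. of_real (f b) * (of_real (torus_point x \<bullet> b) * u x))"
        by (simp add: sum_distrib_left mult_ac)
      show "W (\<lambda>x. of_real (f (torus_point x)) * u x)"
        unfolding eq
      proof (intro W_sum W_scale)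
        fix b :: "complex ^ 'n" assume "b \<in> Basis"
        then obtain m c d where "\<And>x. complex_of_real (torus_point x \<bullet> b) = c * echar m x + d * echar (- m) x"
          using torus_point_inner_Basis[of b] by blast
        then have "(\<lambda>x. of_real (torus_point x \<bullet> b) * u x) = (\<lambda>x. c * (echar m x * u x) + d * (echar (- m) x * u x))"
          by (simp add: algebra_simps)
        then show "W (\<lambda>x. of_real (torus_point x \<bullet> b) * u x)"
          using u by (auto intro!: W_add W_scale W_echar)
      qed simp
    qed
  next
    case (const c) then show ?case by (auto intro: W_scale)
  next
    case (add f g)
    then show ?case by (auto simp: distrib_right intro!: W_add)
  next
    case (mult f g)
    then show ?case by (auto simp: mult.assoc)
  qed
  define H where "H = (LINT x | lebesgue_on unit_cube. F x * of_real (h (torus_point x)))"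
  define I where "I = (LINT x | lebesgue_on unit_cube. norm (F x))"
  have ch: "continuous_on UNIV (\<lambda>x. complex_of_real (h (torus_point x)))"
    by (intro continuous_intros continuous_on_compose2[OF h] continuous_on_torus_point)
       (auto simp: torus_point_in_torus)
  have "norm H \<le> e * I" if e: "0 < e" for e
  proof -
    obtain p where p: "real_polynomial_function p" "\<And>z. z \<in> torus \<Longrightarrow> \<bar>h z - p z\<bar> < e"
      using Stone_Weierstrass_real_polynomial_function[OF compact_torus h e] by blast
    have W1: "W (\<lambda>x. of_real (p (torus_point x)))" using W_poly[OF p(1)] W_1 by force
    have intp: "integrable (lebesgue_on unit_cube) (\<lambda>x. F x * of_real (p (torus_point x)))"
      and zp: "(LINT x | lebesgue_on unit_cube. F x * of_real (p (torus_point x))) = 0"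
      using W1 int[OF W1, of 0] by (auto simp: W_def dest: spec[of _ 0])
    have inth: "integrable (lebesgue_on unit_cube) (\<lambda>x. F x * of_real (h (torus_point x)))"
      by (intro integrable_cube_mult F ch)
    have "H = (LINT x | lebesgue_on unit_cube. F x * of_real (h (torus_point x)) - F x * of_real (p (torus_point x)))"
      unfolding H_def using inth intp zp by simp
    also have "norm \<dots> \<le> (LINT x | lebesgue_on unit_cube. norm (F x * of_real (h (torus_point x)) - F x * of_real (p (torus_point x))))"
      by (rule integral_norm_bound)
    also have "\<dots> \<le> (LINT x | lebesgue_on unit_cube. e * norm (F x))"
    proof (rule integral_mono)
      fix x :: "real ^ 'n"
      have "norm (F x * of_real (h (torus_point x)) - F x * of_real (p (torus_point x)))
          = norm (F x) * \<bar>h (torus_point x) - p (torus_point x)\<bar>"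
        by (metis norm_mult norm_of_real of_real_diff right_diff_distrib)
      then show "norm (F x * of_real (h (torus_point x)) - F x * of_real (p (torus_point x))) \<le> e * norm (F x)"
        using p(2)[OF torus_point_in_torus, of x]
          mult_left_mono[of "\<bar>h (torus_point x) - p (torus_point x)\<bar>" e "norm (F x)"] by (simp add: mult.commute)
    qed (use F inth intp in auto)
    finally show ?thesis by (simp add: I_def)
  qed
  moreover have "((\<lambda>e. e * I) \<longlongrightarrow> 0 * I) (at_right 0)" by (intro tendsto_intros)
  ultimately have "norm H \<le> 0 * I"
    by (intro tendsto_lowerbound[where F = "at_right (0::real)"]) (auto simp: eventually_at_right_field intro: exI[of _ 1])
  then show ?thesis by (simp add: H_def)
qed

lemma torus_point_inj:
  assumes x: "x \<in> box 0 (vec 1)" and y: "y \<in> unit_cube" and eq: "torus_point x = torus_point (y :: real ^ 'n::finite)"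
  shows "x = y"
proof (simp add: vec_eq_iff, intro allI)
  fix i
  have b: "0 < x $ i" "x $ i < 1" "0 \<le> y $ i" "y $ i \<le> 1"
    using x y by (auto simp: mem_box_cart mem_unit_cube)
  have "exp (2 * of_real pi * \<i> * of_real (x $ i)) = exp (2 * of_real pi * \<i> * of_real (y $ i))"
    using arg_cong[OF eq, of "\<lambda>z. z $ i"] by (simp add: torus_point_def)
  then obtain n :: int where "2 * of_real pi * \<i> * of_real (x $ i) = 2 * of_real pi * \<i> * of_real (y $ i) + (of_int (2 * n) * pi) * \<i>"
    by (auto simp: exp_eq)
  then have "Im (2 * of_real pi * \<i> * of_real (x $ i)) = Im (2 * of_real pi * \<i> * of_real (y $ i) + (of_int (2 * n) * pi) * \<i>)"
    by simp
  then have "2 * pi * (x $ i) = 2 * pi * (y $ i + of_int n)" by (simp add: algebra_simps)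
  then have xy: "x $ i = y $ i + of_int n" by simp
  have "of_int (- 1) < (of_int n :: real)" "(of_int n :: real) < of_int 1" using xy b by auto
  then have "n = 0" by (simp only: of_int_less_iff)
  then show "x $ i = y $ i" using xy by simp
qed

text \<open>
Continuous functions on the torus approximate the indicator of any box inside the open unit cube, so
\<open>F\<close> has integral 0 over every such box.  By Lebesgue's differentiation theorem \<open>F\<close> vanishes almost
everywhere.  Boxes inside the open cube are used because \<open>torus_point\<close> identifies opposite faces.
\<close>

theorem fourier_uniqueness_cube:
  fixes F :: "real ^ 'n::finite \<Rightarrow> complex"
  assumes F: "integrable (lebesgue_on unit_cube) F"
    and zero: "\<And>m. (LINT x | lebesgue_on unit_cube. F x * echar m x) = 0"
  shows "AE x in lebesgue_on unit_cube. F x = 0"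
proof -
  have box_zero: "integral (cbox a b) F = 0" if ab: "cbox a b \<subseteq> box 0 (vec 1)" for a b :: "real ^ 'n"
  proof (cases "cbox a b = {}")
    case False
    define K where "K = (torus_point ` cbox a b :: (complex ^ 'n) set)"
    have K: "closed K" "K \<noteq> {}"
      using False unfolding K_def by (auto intro!: compact_imp_closed compact_continuous_image continuous_on_torus_point)
    define h where "h = (\<lambda>(k::nat) z. max 0 (1 - real k * infdist z K))"
    have cont: "continuous_on S (\<lambda>x. complex_of_real (h k (torus_point x)))" for k and S :: "(real ^ 'n) set"
      unfolding h_def by (intro continuous_intros continuous_on_torus_point)
    have sub: "cbox a b \<subseteq> unit_cube" using ab box_subset_cbox[of 0 "vec 1 :: real ^ 'n"] by (auto simp: unit_cube_def)
    have cK: "cbox a b \<in> sets (lebesgue_on unit_cube)"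
      using sub by (auto simp: sets_restrict_space intro!: image_eqI[of _ _ "cbox a b"])
    have hK: "torus_point x \<in> K \<longleftrightarrow> x \<in> cbox a b" if "x \<in> unit_cube" for x
      using that ab torus_point_inj[of _ x] unfolding K_def by force
    have lim: "(\<lambda>k. h k (torus_point x)) \<longlonglongrightarrow> indicator (cbox a b) x" if x: "x \<in> unit_cube" for x
    proof (cases "x \<in> cbox a b")
      case True
      then have "infdist (torus_point x) K = 0" using hK[OF x] K in_closed_iff_infdist_zero by blast
      then show ?thesis using True by (simp add: h_def)
    next
      case False
      then have "infdist (torus_point x) K \<noteq> 0" using hK[OF x] K in_closed_iff_infdist_zero by blast
      then have d: "0 < infdist (torus_point x) K" using infdist_nonneg[of "torus_point x" K] by linarith
      obtain k0 where k0: "1 / infdist (torus_point x) K < real k0" using reals_Archimedean2 by blast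
      have "h k (torus_point x) = 0" if "k \<ge> k0" for k
      proof -
        have "1 < real k0 * infdist (torus_point x) K" using k0 d by (simp add: field_simps)
        also have "\<dots> \<le> real k * infdist (torus_point x) K" using that d by (intro mult_right_mono) auto
        finally show ?thesis by (simp add: h_def)
      qed
      then have "(\<lambda>k. h k (torus_point x)) \<longlonglongrightarrow> 0"
        by (intro tendsto_eventually) (auto simp: eventually_sequentially)
      then show ?thesis using False by simp
    qed
    have "(\<lambda>k. LINT x | lebesgue_on unit_cube. F x * of_real (h k (torus_point x))) \<longlonglongrightarrow>
        (LINT x | lebesgue_on unit_cube. F x * of_real (indicator (cbox a b) x))"
    proof (rule integral_dominated_convergence)
      show "(\<lambda>x. F x * of_real (indicator (cbox a b) x)) \<in> borel_measurable (lebesgue_on unit_cube)"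
      proof -
        have "(\<lambda>x. indicator (cbox a b) x *\<^sub>R F x) \<in> borel_measurable (lebesgue_on unit_cube)"
          using F by (intro borel_measurable_integrable integrable_mult_indicator cK) auto
        then show ?thesis by (simp add: scaleR_conv_of_real mult.commute)
      qed
      show "(\<lambda>x. F x * of_real (h k (torus_point x))) \<in> borel_measurable (lebesgue_on unit_cube)" for k
        by (intro borel_measurable_integrable integrable_cube_mult F cont)
      show "integrable (lebesgue_on unit_cube) (\<lambda>x. norm (F x))" using F by simp
      show "AE x in lebesgue_on unit_cube. (\<lambda>k. F x * of_real (h k (torus_point x))) \<longlonglongrightarrow> F x * of_real (indicator (cbox a b) x)"
        by (intro AE_I2 tendsto_intros lim) simp
      show "AE x in lebesgue_on unit_cube. norm (F x * of_real (h k (torus_point x))) \<le> norm (F x)" for k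
        by (intro AE_I2) (auto simp: norm_mult h_def infdist_nonneg intro!: mult_left_le)
    qed
    moreover have "(LINT x | lebesgue_on unit_cube. F x * of_real (h k (torus_point x))) = 0" for k
      by (intro integral_against_continuous_eq_0 F zero) (auto simp: h_def intro!: continuous_intros)
    ultimately have "(LINT x | lebesgue_on unit_cube. F x * of_real (indicator (cbox a b) x)) = 0"
      by (simp add: LIMSEQ_const_iff)
    also have "(LINT x | lebesgue_on unit_cube. F x * of_real (indicator (cbox a b) x)) =
       (LINT x | lebesgue_on unit_cube. (if x \<in> cbox a b then F x else 0))"
      by (intro Bochner_Integration.integral_cong) (auto simp: indicator_def)
    also have "\<dots> = integral unit_cube (\<lambda>x. if x \<in> cbox a b then F x else 0)"
    proof (rule lebesgue_integral_eq_integral)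
      have "integrable (lebesgue_on unit_cube) (\<lambda>x. indicator (cbox a b) x *\<^sub>R F x)"
        using F by (intro integrable_mult_indicator cK) auto
      then show "integrable (lebesgue_on unit_cube) (\<lambda>x. if x \<in> cbox a b then F x else 0)"
        by (rule Bochner_Integration.integrable_cong[THEN iffD1, rotated -1]) (auto simp: indicator_def)
    qed auto
    also have "\<dots> = integral (cbox a b) F"
      using sub by (subst integral_restrict_Int) (simp add: Int_absorb2 Int_absorb1)
    finally show ?thesis .
  qed auto
  define F0 where "F0 = (\<lambda>x. if x \<in> unit_cube then F x else 0)"
  have "F integrable_on unit_cube" using F by (intro integrable_on_lebesgue_on) auto
  then have "F0 integrable_on UNIV"
    by (simp add: F0_def Henstock_Kurzweil_Integration.integrable_restrict_UNIV)
  then have "F0 integrable_on cbox a b" for a b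
    by (rule integrable_on_subcbox) simp
  then obtain N where N: "negligible N"
    "\<And>x e. \<lbrakk>x \<notin> N; 0 < e\<rbrakk> \<Longrightarrow> \<exists>d>0. \<forall>h. 0 < h \<and> h < d \<longrightarrow>
       norm (integral (cbox x (x + h *\<^sub>R One)) F0 /\<^sub>R h ^ DIM(real ^ 'n) - F0 x) < e"
    by (rule integrable_ccontinuous_explicit) blast
  have zeroN: "F x = 0" if x: "x \<in> box 0 (vec 1)" "x \<notin> N" for x
  proof (rule ccontr)
    assume "F x \<noteq> 0"
    then obtain d where d: "d > 0" "\<And>h. 0 < h \<Longrightarrow> h < d \<Longrightarrow>
       norm (integral (cbox x (x + h *\<^sub>R One)) F0 /\<^sub>R h ^ DIM(real ^ 'n) - F0 x) < norm (F x)"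
      using N(2)[OF x(2), of "norm (F x)"] by auto
    obtain r where r: "0 < r" "cball x r \<subseteq> box 0 (vec 1)"
      using x(1) open_contains_cball[of "box 0 (vec 1)"] by auto
    define h where "h = min (d / 2) (r / norm (One :: real ^ 'n))"
    have One: "0 < norm (One :: real ^ 'n)" using nonempty_Basis One_neq_0 by auto
    have h: "0 < h" "h < d" "h * norm (One :: real ^ 'n) \<le> r"
      using d(1) r(1) One by (auto simp: h_def min_def field_simps)
    have sub: "cbox x (x + h *\<^sub>R One) \<subseteq> box 0 (vec 1)"
    proof
      fix y assume y: "y \<in> cbox x (x + h *\<^sub>R One)"
      have "norm (y - x) \<le> norm (h *\<^sub>R (One :: real ^ 'n))"
      proof (rule norm_le_componentwise)
        fix b :: "real ^ 'n" assume "b \<in> Basis"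
        with y show "\<bar>(y - x) \<bullet> b\<bar> \<le> \<bar>(h *\<^sub>R One) \<bullet> b\<bar>"
          by (auto simp: mem_box inner_diff_left inner_add_left)
      qed
      then have "y \<in> cball x r" using h by (simp add: dist_norm norm_minus_commute)
      then show "y \<in> box 0 (vec 1)" using r by blast
    qed
    have cu: "box 0 (vec 1) \<subseteq> (unit_cube :: (real ^ 'n) set)" by (simp add: unit_cube_def box_subset_cbox)
    have "integral (cbox x (x + h *\<^sub>R One)) F0 = integral (cbox x (x + h *\<^sub>R One)) F"
      using sub cu by (intro integral_cong) (auto simp: F0_def)
    then show False using d(2)[OF h(1,2)] box_zero[OF sub] x(1) cu by (auto simp: F0_def)
  qed
  have "negligible (N \<union> (cbox 0 (vec 1) - box 0 (vec 1 :: real ^ 'n)))"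
    by (intro negligible_Un N(1) negligible_frontier_interval)
  then have null: "N \<union> (cbox 0 (vec 1) - box 0 (vec 1)) \<in> null_sets lebesgue" by (simp add: negligible_iff_null_sets)
  have "AE x in lebesgue. x \<in> unit_cube \<longrightarrow> F x = 0"
    by (rule AE_I'[OF null]) (use zeroN in \<open>auto simp: unit_cube_def\<close>)
  then show ?thesis by (subst AE_restrict_space_iff) auto
qed

section \<open>Repeated averaging over segments\<close>

text \<open>
Given as a density on the whole line, so that its measurable sets are all Borel sets and continuous
functions on the line are measurable without restriction.
\<close>

definition unit_unif :: "real measure" where
  "unit_unif = density lborel (\<lambda>s. ennreal (indicator {0..1} s))"

lemma sets_unit_unif [measurable_cong, simp]: "sets unit_unif = sets borel"
  and space_unit_unif [simp]: "space unit_unif = UNIV"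
  by (simp_all add: unit_unif_def)

lemma emeasure_unit_unif: "emeasure unit_unif UNIV = 1"
proof -
  have "emeasure unit_unif UNIV = (\<integral>\<^sup>+s. indicator {0..1} (s :: real) \<partial>lborel)"
    unfolding unit_unif_def by (subst emeasure_density) (simp_all add: ennreal_indicator)
  then show ?thesis by simp
qed

interpretation unit_unif: finite_measure unit_unif
  by standard (simp add: emeasure_unit_unif)

lemma AE_unit_unif: "AE s in unit_unif. 0 \<le> s \<and> s \<le> 1"
  unfolding unit_unif_def by (subst AE_density) (auto simp: indicator_def)

lemma measure_unit_unif [simp]: "measure unit_unif UNIV = 1"
  by (simp add: measure_def emeasure_unit_unif)

definition average :: "real ^ 'n \<Rightarrow> (real ^ 'n \<Rightarrow> real) \<Rightarrow> real ^ 'n::finite \<Rightarrow> real" where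
  "average v u x = (LINT s | unit_unif. u (x - s *\<^sub>R v))"

text \<open>
The Fourier transform of a function on Euclidean space, at lattice points only: for a function
supported in the unit cube these are its Fourier coefficients on the torus.
\<close>

definition ft :: "(real ^ 'n \<Rightarrow> real) \<Rightarrow> int ^ 'n::finite \<Rightarrow> complex" where
  "ft u m = (LINT x | lborel. of_real (u x) * echar (- m) x)"

definition multiplier :: "real ^ 'n \<Rightarrow> int ^ 'n::finite \<Rightarrow> complex" where
  "multiplier v m = (LINT s | unit_unif. echar (- m) (s *\<^sub>R v))"

text \<open>
The Lipschitz constant 1 is built in because averaging preserves it; it is what makes the iterated
averages converge uniformly.
\<close>

definition bump :: "real \<Rightarrow> real \<Rightarrow> (real ^ 'n::finite \<Rightarrow> real) \<Rightarrow> bool" where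
  "bump B R u \<longleftrightarrow> (\<forall>x. 0 \<le> u x \<and> u x \<le> B) \<and> (\<forall>x y. \<bar>u x - u y\<bar> \<le> norm (x - y)) \<and> (\<forall>x. R < norm x \<longrightarrow> u x = 0)"

lemma bump_continuous: "bump B R u \<Longrightarrow> continuous_on S u"
  unfolding bump_def continuous_on_iff dist_norm
  by (metis order_le_less_trans real_norm_def)

lemma bump_measurable: "bump B R u \<Longrightarrow> u \<in> borel_measurable borel"
  by (intro borel_measurable_continuous_onI bump_continuous)

lemma bump_integrable_shift:
  assumes u: "bump B R u"
  shows "integrable unit_unif (\<lambda>s. u (x - s *\<^sub>R v))"
proof (rule unit_unif.integrable_const_bound[where B = B])
  note [measurable] = bump_measurable[OF u]
  show "AE s in unit_unif. norm (u (x - s *\<^sub>R v)) \<le> B"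
    using u by (simp add: bump_def)
  show "(\<lambda>s. u (x - s *\<^sub>R v)) \<in> borel_measurable unit_unif" by measurable
qed

lemma bump_average:
  fixes u :: "real ^ 'n::finite \<Rightarrow> real"
  assumes u: "bump B R u"
  shows "bump B (R + norm v) (average v u)"
  unfolding bump_def
proof (intro conjI allI impI)
  note int = bump_integrable_shift[OF u]
  fix x y
  show "0 \<le> average v u x" unfolding average_def using u by (intro Bochner_Integration.integral_nonneg) (auto simp: bump_def)
  have "average v u x \<le> (LINT s | unit_unif. B)"
    unfolding average_def using u by (intro integral_mono int) (auto simp: bump_def)
  then show "average v u x \<le> B" by simp
  have "\<bar>average v u x - average v u y\<bar> = \<bar>LINT s | unit_unif. u (x - s *\<^sub>R v) - u (y - s *\<^sub>R v)\<bar>"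
    unfolding average_def using int by simp
  also have "\<dots> \<le> (LINT s | unit_unif. \<bar>u (x - s *\<^sub>R v) - u (y - s *\<^sub>R v)\<bar>)"
    by (rule integral_abs_bound)
  also have "\<dots> \<le> (LINT s | unit_unif. norm (x - y))"
  proof (rule integral_mono)
    fix s show "\<bar>u (x - s *\<^sub>R v) - u (y - s *\<^sub>R v)\<bar> \<le> norm (x - y)"
      using u unfolding bump_def by (metis diff_diff_eq2 diff_add_cancel)
  qed (use int in auto)
  finally show "\<bar>average v u x - average v u y\<bar> \<le> norm (x - y)" by simp
next
  fix x :: "real ^ 'n" assume x: "R + norm v < norm x"
  have "average v u x = (LINT s | unit_unif. 0)"
    unfolding average_def
  proof (rule integral_cong_AE)
    note [measurable] = bump_measurable[OF u]
    show "(\<lambda>s. u (x - s *\<^sub>R v)) \<in> borel_measurable unit_unif" by measurable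
    show "AE s in unit_unif. u (x - s *\<^sub>R v) = 0"
      using AE_unit_unif
    proof eventually_elim
      case (elim s)
      have "norm (s *\<^sub>R v) \<le> norm v" using elim by (simp add: mult_left_le_one_le)
      then have "R < norm (x - s *\<^sub>R v)" using x norm_triangle_ineq2[of x "s *\<^sub>R v"] by linarith
      then show ?case using u by (simp add: bump_def)
    qed
  qed simp
  then show "average v u x = 0" by simp
qed

lemma average_close:
  fixes u :: "real ^ 'n::finite \<Rightarrow> real"
  assumes u: "bump B R u"
  shows "\<bar>average v u x - u x\<bar> \<le> norm v"
proof -
  note int = bump_integrable_shift[OF u]
  have "\<bar>average v u x - u x\<bar> = \<bar>LINT s | unit_unif. u (x - s *\<^sub>R v) - u x\<bar>"
    unfolding average_def using int by simp
  also have "\<dots> \<le> (LINT s | unit_unif. \<bar>u (x - s *\<^sub>R v) - u x\<bar>)"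
    by (rule integral_abs_bound)
  also have "\<dots> \<le> (LINT s | unit_unif. norm v)"
  proof (rule integral_mono_AE)
    show "AE s in unit_unif. \<bar>u (x - s *\<^sub>R v) - u x\<bar> \<le> norm v"
      using AE_unit_unif
    proof eventually_elim
      case (elim s)
      have "\<bar>u (x - s *\<^sub>R v) - u x\<bar> \<le> norm (x - s *\<^sub>R v - x)" using u unfolding bump_def by blast
      also have "\<dots> \<le> norm v" using elim by (simp add: mult_left_le_one_le)
      finally show ?case .
    qed
  qed (use int in auto)
  finally show ?thesis by simp
qed

lemma integrable_bump:
  fixes u :: "real ^ 'n::finite \<Rightarrow> real"
  assumes u: "bump B R u" and g: "g \<in> borel_measurable borel" "\<And>x. norm (g x :: complex) \<le> 1"
  shows "integrable lborel (\<lambda>x. of_real (u x) * g x)"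
proof (rule integrableI_bounded_set[where A = "cball 0 R" and B = B])
  note [measurable] = bump_measurable[OF u] g(1)
  show "(\<lambda>x. of_real (u x) * g x) \<in> borel_measurable lborel" by measurable
  show "emeasure lborel (cball 0 R :: (real ^ 'n) set) < \<infinity>" using emeasure_bounded_finite[of "cball (0 :: real ^ 'n) R"] by simp
  show "AE x in lborel. x \<in> cball 0 R \<longrightarrow> norm (of_real (u x) * g x) \<le> B"
  proof (intro AE_I2 impI)
    fix x
    have "norm (of_real (u x) * g x) \<le> B * 1"
      unfolding norm_mult using u g(2) by (intro mult_mono) (auto simp: bump_def intro: order_trans)
    then show "norm (of_real (u x) * g x) \<le> B" by simp
  qed
  show "AE x in lborel. x \<notin> cball 0 R \<longrightarrow> of_real (u x) * g x = 0" using u by (auto simp: bump_def)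
qed auto

lemma integrable_bump_real:
  fixes u :: "real ^ 'n::finite \<Rightarrow> real"
  assumes u: "bump B R u"
  shows "integrable lborel u"
  using integrable_bump[OF u, of "\<lambda>_. 1"] by (simp add: complex_of_real_integrable_eq)

text \<open>
Averaging over the segment from 0 to \<open>v\<close> is convolution with a probability measure, and
\<open>multiplier v\<close> is the Fourier transform of that measure.
\<close>

lemma ft_average:
  fixes u :: "real ^ 'n::finite \<Rightarrow> real"
  assumes u: "bump B R u"
  shows "ft (average v u) m = multiplier v m * ft u m"
proof -
  interpret pair_sigma_finite "lborel :: (real ^ 'n) measure" unit_unif ..
  note [measurable] = bump_measurable[OF u]
  let ?f = "\<lambda>x s. of_real (u (x - s *\<^sub>R v)) * echar (- m) x"
  let ?Q = "lborel \<Otimes>\<^sub>M unit_unif :: ((real ^ 'n) \<times> real) measure"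
  let ?A = "cball (0 :: real ^ 'n) (R + norm v) \<times> (UNIV :: real set)"
  have int: "integrable ?Q (\<lambda>(x, s). ?f x s)"
  proof (rule integrableI_bounded_set[where A = ?A and B = B])
    show "?A \<in> sets ?Q" by auto
    show "(\<lambda>(x, s). ?f x s) \<in> borel_measurable ?Q" by measurable
    show "emeasure ?Q ?A < \<infinity>"
      using emeasure_bounded_finite[of "cball (0 :: real ^ 'n) (R + norm v)"]
      by (subst unit_unif.emeasure_pair_measure_Times) (auto simp: emeasure_unit_unif)
    show "AE p in ?Q. p \<in> ?A \<longrightarrow> norm ((\<lambda>(x, s). ?f x s) p) \<le> B"
      using u by (intro AE_I2) (auto simp: norm_mult bump_def)
    have "AE p in ?Q. 0 \<le> snd p \<and> snd p \<le> 1"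
    proof (rule AE_pair_measure)
      show "{p \<in> space ?Q. 0 \<le> snd p \<and> snd p \<le> 1} \<in> sets ?Q"
        by measurable
      show "AE x in lborel. AE s in unit_unif. 0 \<le> snd (x, s) \<and> snd (x, s) \<le> 1"
        using AE_unit_unif by simp
    qed
    then show "AE p in ?Q. p \<notin> ?A \<longrightarrow> (\<lambda>(x, s). ?f x s) p = 0"
    proof eventually_elim
      case (elim p)
      show ?case
      proof
        assume "p \<notin> ?A"
        obtain x s where p: "p = (x, s)" by (cases p)
        have "norm (s *\<^sub>R v) \<le> norm v" using elim p by (simp add: mult_left_le_one_le)
        then have "R < norm (x - s *\<^sub>R v)"
          using \<open>p \<notin> ?A\<close> p norm_triangle_ineq2[of x "s *\<^sub>R v"] by auto
        then show "(\<lambda>(x, s). ?f x s) p = 0" using u by (simp add: bump_def p)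
      qed
    qed
  qed
  have "ft (average v u) m = (LINT x | lborel. LINT s | unit_unif. ?f x s)"
    unfolding ft_def average_def by (simp flip: integral_complex_of_real)
  also have "\<dots> = (LINT s | unit_unif. LINT x | lborel. ?f x s)"
    using Fubini_integral[OF int] by simp
  also have "\<dots> = (LINT s | unit_unif. echar (- m) (s *\<^sub>R v) * ft u m)"
  proof (intro Bochner_Integration.integral_cong refl)
    fix s
    have "(LINT x | lborel. ?f x s) = (LINT x | distr lborel borel ((+) (s *\<^sub>R v)). ?f x s)"
      by (simp only: lborel_distr_plus)
    also have "\<dots> = (LINT y | lborel. ?f (s *\<^sub>R v + y) s)"
      by (rule integral_distr) measurable
    also have "\<dots> = (LINT y | lborel. echar (- m) (s *\<^sub>R v) * (of_real (u y) * echar (- m) y))"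
      by (simp add: echar_add mult_ac)
    also have "\<dots> = echar (- m) (s *\<^sub>R v) * ft u m" by (simp add: ft_def)
    finally show "(LINT x | lborel. ?f x s) = echar (- m) (s *\<^sub>R v) * ft u m" .
  qed
  also have "\<dots> = multiplier v m * ft u m" by (simp add: multiplier_def)
  finally show ?thesis .
qed

lemma norm_multiplier_le_1: "norm (multiplier v m) \<le> 1"
proof -
  have "norm (multiplier v m) \<le> (LINT s | unit_unif. norm (echar (- m) (s *\<^sub>R v)))"
    unfolding multiplier_def by (rule integral_norm_bound)
  then show ?thesis by simp
qed

lemma norm_multiplier_le:
  assumes c: "lattice_vec m \<bullet> v \<noteq> 0"
  shows "norm (multiplier v m) \<le> 1 / (pi * \<bar>lattice_vec m \<bullet> v\<bar>)"
proof -
  define a where "a = - 2 * pi * (lattice_vec m \<bullet> v)"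
  have a: "a \<noteq> 0" using c by (simp add: a_def)
  have "multiplier v m = (LINT s | lborel. indicator {0..1} s *\<^sub>R cis (a * s))"
    unfolding multiplier_def unit_unif_def
    by (subst integral_density) (auto simp: echar_def lattice_vec_minus a_def mult_ac intro!: borel_measurable_continuous_onI continuous_intros)
  also have "\<dots> = (cis a - 1) / (\<i> * of_real a)" by (rule integral_cis[OF a])
  also have "norm \<dots> \<le> 2 / \<bar>a\<bar>"
    using norm_triangle_ineq4[of "cis a" 1] by (simp add: norm_divide norm_mult divide_right_mono)
  also have "\<dots> = 1 / (pi * \<bar>lattice_vec m \<bullet> v\<bar>)" by (simp add: a_def abs_mult)
  finally show ?thesis .
qed

lemma bump_cone: "0 < d \<Longrightarrow> bump d d (\<lambda>x. max 0 (d - norm x))"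
  unfolding bump_def by (auto simp: max_def) (use norm_triangle_ineq2 norm_triangle_ineq3 in \<open>smt (verit)\<close>)+

text \<open>
Infinitely many averages are applied to a cone.  Each moves the function by at most the length of its
segment in the uniform norm and enlarges the support by as much, so the process converges if the total
length is finite.  In the limit any finite set \<open>J\<close> of the multipliers may be kept in the estimate, as
all have modulus at most 1.  The integral is the Fourier transform at 0 and stays unchanged.
\<close>

lemma infinite_average_bump:
  fixes v :: "nat \<Rightarrow> real ^ 'n::finite"
  assumes d: "0 < d" and v: "summable (\<lambda>k. norm (v k))"
  obtains u B where "bump B (d + (\<Sum>k. norm (v k))) u" "0 < (LINT x | lborel. u x)"
    "\<And>m J. finite J \<Longrightarrow> norm (ft u m) \<le> (LINT x | lborel. u x) * (\<Prod>k\<in>J. norm (multiplier (v k) m))"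
proof -
  define U where "U = rec_nat (\<lambda>x. max 0 (d - norm x)) (\<lambda>k u. average (v k) u)"
  have U0: "U 0 = (\<lambda>x. max 0 (d - norm x))" and US: "\<And>k. U (Suc k) = average (v k) (U k)"
    by (simp_all add: U_def)
  define R where "R = d + (\<Sum>k. norm (v k))"
  have Ub': "bump d (d + (\<Sum>k<K. norm (v k))) (U K)" for K
  proof (induction K)
    case 0
    show ?case using bump_cone[OF d] by (simp add: U0)
  next
    case (Suc K)
    show ?case using bump_average[OF Suc, of "v K"] by (simp add: US add.assoc)
  qed
  have Ub: "bump d R (U K)" for K
  proof -
    have "d + (\<Sum>k<K. norm (v k)) \<le> R" unfolding R_def using v by (intro add_left_mono sum_le_suminf) auto
    then show ?thesis using Ub'[of K] by (auto simp: bump_def)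
  qed
  define u where "u = (\<lambda>x. lim (\<lambda>K. U K x))"
  have lim: "(\<lambda>K. U K x) \<longlonglongrightarrow> u x" for x
  proof -
    have "summable (\<lambda>K. U (Suc K) x - U K x)"
      by (rule summable_comparison_test'[OF v, of 0]) (simp add: US average_close[OF Ub])
    then have "(\<lambda>K. \<Sum>k<K. U (Suc k) x - U k x) \<longlonglongrightarrow> (\<Sum>k. U (Suc k) x - U k x)" by (rule summable_LIMSEQ)
    then have "(\<lambda>K. U K x - U 0 x + U 0 x) \<longlonglongrightarrow> (\<Sum>k. U (Suc k) x - U k x) + U 0 x"
      by (intro tendsto_add tendsto_const) (simp add: sum_lessThan_telescope[of "\<lambda>k. U k x"])
    then have "convergent (\<lambda>K. U K x)" by (auto simp: convergent_def)
    then show ?thesis by (simp add: u_def convergent_LIMSEQ_iff)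
  qed
  have u: "bump d R u"
    unfolding bump_def
  proof (intro conjI allI impI)
    fix x y
    show "0 \<le> u x" by (rule LIMSEQ_le_const[OF lim]) (use Ub in \<open>auto simp: bump_def\<close>)
    show "u x \<le> d" by (rule LIMSEQ_le_const2[OF lim]) (use Ub in \<open>auto simp: bump_def\<close>)
    show "\<bar>u x - u y\<bar> \<le> norm (x - y)"
      by (rule LIMSEQ_le_const2[OF tendsto_rabs[OF tendsto_diff[OF lim lim]]]) (use Ub in \<open>auto simp: bump_def\<close>)
  next
    fix x :: "real ^ 'n" assume "R < norm x"
    then have "\<And>K. U K x = 0" using Ub by (auto simp: bump_def)
    with lim[of x] show "u x = 0" by (simp add: LIMSEQ_const_iff)
  qed
  have flim: "(\<lambda>K. ft (U K) m) \<longlonglongrightarrow> ft u m" for m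
    unfolding ft_def
  proof (rule integral_dominated_convergence)
    note [measurable] = bump_measurable[OF u] bump_measurable[OF Ub]
    show "(\<lambda>x. of_real (u x) * echar (- m) x) \<in> borel_measurable lborel" by measurable
    show "\<And>K. (\<lambda>x. of_real (U K x) * echar (- m) x) \<in> borel_measurable lborel" by measurable
    show "integrable lborel (\<lambda>x :: real ^ 'n. d * indicator (cball 0 R) x)"
      using emeasure_bounded_finite[of "cball (0 :: real ^ 'n) R"] by (intro integrable_mult_right integrable_real_indicator) auto
    show "AE x in lborel. (\<lambda>K. of_real (U K x) * echar (- m) x) \<longlonglongrightarrow> of_real (u x) * echar (- m) x"
      by (intro AE_I2 tendsto_intros lim)
    show "AE x in lborel. norm (of_real (U K x) * echar (- m) x) \<le> d * indicator (cball 0 R) x" for K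
      using Ub[of K] by (intro AE_I2) (auto simp: norm_mult bump_def indicator_def)
  qed
  have fU: "ft (U K) m = (\<Prod>k<K. multiplier (v k) m) * ft (U 0) m" for K m
    by (induction K) (simp_all add: US ft_average[OF Ub] mult_ac)
  have ft0: "ft w 0 = of_real (LINT x | lborel. w x)" for w :: "real ^ 'n \<Rightarrow> real"
    by (simp add: ft_def)
  have "ft (U K) 0 = ft (U 0) 0" for K
    using fU[of K 0] by (simp add: multiplier_def)
  then have "(\<lambda>K. ft (U K) 0) = (\<lambda>_. ft (U 0) 0)" by (rule ext)
  then have "ft u 0 = ft (U 0) 0" using flim[of 0] by (simp add: LIMSEQ_const_iff)
  then have I: "(LINT x | lborel. u x) = (LINT x | lborel. U 0 x)" by (simp add: ft0)
  have pos: "0 < (LINT x | lborel. U 0 x)"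
  proof -
    have "0 < (LINT x | lborel. (d / 2) * indicator (cball (0 :: real ^ 'n) (d / 2)) x)"
      using d content_cball_pos[of "d / 2" "0 :: real ^ 'n"] by simp
    also have "\<dots> \<le> (LINT x | lborel. U 0 x)"
    proof (rule integral_mono)
      show "integrable lborel (\<lambda>x :: real ^ 'n. (d / 2) * indicator (cball 0 (d / 2)) x)"
        using emeasure_bounded_finite[of "cball (0 :: real ^ 'n) (d / 2)"] by (intro integrable_mult_right integrable_real_indicator) auto
      show "integrable lborel (U 0)" by (rule integrable_bump_real[OF Ub])
      show "(d / 2) * indicator (cball 0 (d / 2)) x \<le> U 0 x" for x
        using d by (auto simp: U0 indicator_def)
    qed
    finally show ?thesis .
  qed
  have bnd: "norm (ft u m) \<le> (LINT x | lborel. u x) * (\<Prod>k\<in>J. norm (multiplier (v k) m))" if J: "finite J" for m J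
  proof (rule LIMSEQ_le_const2[OF tendsto_norm[OF flim]])
    obtain K0 where K0: "J \<subseteq> {..<K0}" using finite_nat_iff_bounded J by blast
    have f0: "norm (ft (U 0) m) \<le> (LINT x | lborel. u x)"
    proof -
      have "norm (ft (U 0) m) \<le> (LINT x | lborel. norm (of_real (U 0 x) * echar (- m) x))"
        unfolding ft_def by (rule integral_norm_bound)
      also have "\<dots> = (LINT x | lborel. U 0 x)"
        by (intro Bochner_Integration.integral_cong refl) (simp add: norm_mult U0)
      finally show ?thesis by (simp add: I)
    qed
    show "\<exists>N. \<forall>K\<ge>N. norm (ft (U K) m) \<le> (LINT x | lborel. u x) * (\<Prod>k\<in>J. norm (multiplier (v k) m))"
    proof (intro exI[of _ K0] allI impI)
      fix K assume "K0 \<le> K"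
      then have JK: "J \<subseteq> {..<K}" using K0 by auto
      have "norm (ft (U K) m) = norm (ft (U 0) m) * (\<Prod>k<K. norm (multiplier (v k) m))"
        by (simp add: fU[of K] norm_mult prod_norm mult.commute)
      also have "\<dots> \<le> (LINT x | lborel. u x) * (\<Prod>k\<in>J. norm (multiplier (v k) m))"
      proof (rule mult_mono)
        have "(\<Prod>k<K. norm (multiplier (v k) m)) = (\<Prod>k\<in>J. norm (multiplier (v k) m)) * (\<Prod>k\<in>{..<K} - J. norm (multiplier (v k) m))"
          using JK by (subst prod.subset_diff[of J]) (auto simp: mult.commute)
        also have "\<dots> \<le> (\<Prod>k\<in>J. norm (multiplier (v k) m)) * 1"
          by (intro mult_left_mono prod_le_1 prod_nonneg) (auto simp: norm_multiplier_le_1)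
        finally show "(\<Prod>k<K. norm (multiplier (v k) m)) \<le> (\<Prod>k\<in>J. norm (multiplier (v k) m))" by simp
      qed (use f0 pos I in \<open>auto intro!: prod_nonneg\<close>)
      finally show "norm (ft (U K) m) \<le> (LINT x | lborel. u x) * (\<Prod>k\<in>J. norm (multiplier (v k) m))" .
    qed
  qed
  show ?thesis
    by (rule that[OF u[unfolded R_def]]) (use pos I bnd in auto)
qed

section \<open>Ingham's bump functions\<close>

lemma bump_mono: "bump B R u \<Longrightarrow> R \<le> R' \<Longrightarrow> bump B R' u"
  by (auto simp: bump_def)

lemma summable_div_repeat:
  fixes r :: "nat \<Rightarrow> real"
  assumes r: "summable r" "\<And>j. 0 \<le> r j" and n: "0 < n"
  shows "summable (\<lambda>k. r (k div n))" "(\<Sum>k. r (k div n)) \<le> real n * suminf r"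
proof -
  have bound: "(\<Sum>k<K. r (k div n)) \<le> real n * suminf r" for K
  proof -
    have "(\<Sum>k<K. r (k div n)) \<le> (\<Sum>k<K * n. r (k div n))"
      using n by (intro sum_mono2 r) auto
    also have "\<dots> = (\<Sum>j<K. \<Sum>k = j * n..<j * n + n. r (k div n))"
      by (rule sum.nat_group[symmetric])
    also have "\<dots> = (\<Sum>j<K. real n * r j)"
    proof (intro sum.cong refl)
      fix j
      have "(\<Sum>k = j * n..<j * n + n. r (k div n)) = (\<Sum>k = j * n..<j * n + n. r j)"
      proof (intro sum.cong refl arg_cong[where f = r])
        fix k assume "k \<in> {j * n..<j * n + n}"
        then have "j * n \<le> k" "k < Suc j * n" by auto
        then show "k div n = j" using n by (intro div_nat_eqI) (auto simp: mult.commute)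
      qed
      then show "(\<Sum>k = j * n..<j * n + n. r (k div n)) = real n * r j" by simp
    qed
    also have "\<dots> = real n * (\<Sum>j<K. r j)" by (simp add: sum_distrib_left)
    also have "\<dots> \<le> real n * suminf r" by (intro mult_left_mono sum_le_suminf r) auto
    finally show ?thesis .
  qed
  show s: "summable (\<lambda>k. r (k div n))" by (rule summableI_nonneg_bounded[OF r(2) bound])
  show "(\<Sum>k. r (k div n)) \<le> real n * suminf r" by (rule suminf_le_const[OF s bound])
qed

lemma eventually_small_of_summable:
  fixes t :: "real \<Rightarrow> real"
  assumes dec: "\<And>r s. 1 \<le> r \<Longrightarrow> r \<le> s \<Longrightarrow> t s \<le> t r"
    and sum: "summable (\<lambda>k. t (real (Suc k)) / real (Suc k))"
  obtains R where "1 \<le> R" "\<And>r. R \<le> r \<Longrightarrow> t r \<le> 1"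
proof (cases "\<exists>R\<ge>1. t R \<le> 1")
  case True
  then show ?thesis using dec that by (meson order_trans)
next
  case False
  then have t1: "1 \<le> t (real (Suc k))" for k
    by (metis linear of_nat_1 of_nat_mono Suc_le_mono One_nat_def le0)
  have "summable (\<lambda>k. 1 / real (Suc k))"
    by (rule summable_comparison_test'[OF sum, of 0]) (use t1 in \<open>auto intro!: divide_right_mono\<close>)
  then have "summable (\<lambda>k. inverse (real k))"
    by (subst (asm) summable_Suc_iff) (simp add: divide_inverse)
  then show ?thesis using not_summable_harmonic[where 'a = real] by simp
qed

text \<open>
Ingham's construction.  Averages in each coordinate direction are taken over segments of length
\<open>\<rho>\<^sub>k = (e / \<pi>) n \<Theta>(k) / k\<close>, where \<open>n\<close> is the dimension, from some index on; the total length is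
finite because the series converges, and small if it starts late.  Let \<open>r\<close> be the largest coordinate
of \<open>m\<close> in modulus, and \<open>t(r) = n \<Theta>(r)\<close>.  For \<open>k \<le> t(r) r \<le> r\<close>, monotonicity gives
\<open>\<pi> \<rho>\<^sub>k r \<ge> e\<close>, so that the multiplier of the \<open>k\<close>-th average in the direction of that coordinate is
at most \<open>1 / e\<close>.  There are about \<open>t(r) r\<close> such multipliers, and \<open>t(r) r \<ge> \<Theta>(\<bar>m\<bar>) \<bar>m\<bar>\<close> because
\<open>r \<le> \<bar>m\<bar> \<le> n r\<close>.
\<close>

theorem ingham_bump:
  fixes \<Theta> :: "real \<Rightarrow> real"
  assumes nonneg: "\<And>r. 1 \<le> r \<Longrightarrow> 0 \<le> \<Theta> r"
    and dec: "\<And>r s. 1 \<le> r \<Longrightarrow> r \<le> s \<Longrightarrow> \<Theta> s \<le> \<Theta> r"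
    and sum: "summable (\<lambda>k. \<Theta> (real (Suc k)) / real (Suc k))"
    and \<delta>: "0 < \<delta>"
  obtains u :: "real ^ 'n::finite \<Rightarrow> real" and B C where
    "bump B \<delta> u" "0 < (LINT x | lborel. u x)"
    "\<And>m. norm (ft u m) \<le> C * exp (- (\<Theta> (norm (lattice_vec m)) * norm (lattice_vec m)))"
proof -
  define n where "n = CARD('n)"
  have n: "0 < n" by (simp add: n_def)
  define t where "t = (\<lambda>r. real n * \<Theta> r)"
  have t_nn: "0 \<le> t r" if "1 \<le> r" for r using nonneg[OF that] by (simp add: t_def)
  have t_dec: "t s \<le> t r" if "1 \<le> r" "r \<le> s" for r s
    using dec[OF that] by (simp add: t_def mult_left_mono)
  have t_sum: "summable (\<lambda>k. t (real (Suc k)) / real (Suc k))"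
    using summable_mult[OF sum, of "real n"] by (simp add: t_def)
  \<comment> \<open>Beyond \<open>R\<close> the number \<open>t r * r\<close> of useful averages does not exceed \<open>r\<close>.\<close>
  obtain R where R: "1 \<le> R" "\<And>r. R \<le> r \<Longrightarrow> t r \<le> 1"
    using eventually_small_of_summable[OF t_dec t_sum] by blast
  define \<rho> where "\<rho> = (\<lambda>j. exp 1 / pi * (t (real (Suc j)) / real (Suc j)))"
  have \<rho>_nn: "0 \<le> \<rho> j" for j unfolding \<rho>_def using t_nn[of "real (Suc j)"] by simp
  have \<rho>_sum: "summable \<rho>" unfolding \<rho>_def by (intro summable_mult t_sum)
  have "(\<lambda>k0. \<Sum>j. \<rho> (j + k0)) \<longlonglongrightarrow> 0" using suminf_exist_split2[OF \<rho>_sum] .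
  then have "eventually (\<lambda>k0. (\<Sum>j. \<rho> (j + k0)) < \<delta> / 2 / real n) sequentially"
    by (rule order_tendstoD) (use \<delta> n in auto)
  then obtain k0 where k0: "(\<Sum>j. \<rho> (j + k0)) < \<delta> / 2 / real n" by (auto simp: eventually_sequentially)
  have tail_sum: "summable (\<lambda>j. \<rho> (j + k0))" using \<rho>_sum by (subst summable_iff_shift)
  obtain e :: "nat \<Rightarrow> 'n" where e: "bij_betw e {..<n} UNIV"
    using ex_bij_betw_nat_finite[of "UNIV :: 'n set"] by (auto simp: n_def lessThan_atLeast0)
  \<comment> \<open>The averages run through all \<open>n\<close> coordinate directions before the length changes.\<close>
  define v :: "nat \<Rightarrow> real ^ 'n" where "v = (\<lambda>k. \<rho> (k div n + k0) *\<^sub>R axis (e (k mod n)) 1)"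
  have norm_v: "norm (v k) = \<rho> (k div n + k0)" for k using \<rho>_nn by (simp add: v_def)
  note rep = summable_div_repeat[OF tail_sum \<rho>_nn n]
  have v_sum: "summable (\<lambda>k. norm (v k))" unfolding norm_v by (rule rep)
  have "(\<Sum>k. norm (v k)) \<le> real n * (\<Sum>j. \<rho> (j + k0))" unfolding norm_v by (rule rep)
  also have "\<dots> \<le> \<delta> / 2" using k0 n by (simp add: field_simps)
  finally have tot: "\<delta> / 2 + (\<Sum>k. norm (v k)) \<le> \<delta>" by simp
  obtain u B where u: "bump B (\<delta> / 2 + (\<Sum>k. norm (v k))) u" "0 < (LINT x | lborel. u x)"
    "\<And>m J. finite J \<Longrightarrow> norm (ft u m) \<le> (LINT x | lborel. u x) * (\<Prod>k\<in>J. norm (multiplier (v k) m))"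
    by (rule infinite_average_bump[OF half_gt_zero[OF \<delta>] v_sum]) blast
  define I where "I = (LINT x | lborel. u x)"
  \<comment> \<open>The first exponential pays for the \<open>k0\<close> omitted averages and for rounding \<open>t r * r\<close> down; the
    second one covers the finitely many \<open>m\<close> with \<open>r < R\<close>.\<close>
  define C where "C = I * (exp (real k0 + 1) + exp (t 1 * R))"
  have I: "0 < I" using u(2) by (simp add: I_def)
  show ?thesis
  proof (rule that[of B u C])
    show "bump B \<delta> u" by (rule bump_mono[OF u(1) tot])
    show "0 < (LINT x | lborel. u x)" by (rule u)
    fix m :: "int ^ 'n"
    let ?w = "\<Theta> (norm (lattice_vec m)) * norm (lattice_vec m)"
    show "norm (ft u m) \<le> C * exp (- ?w)"
    proof (cases "m = 0")
      case True
      have "I * 1 \<le> I * (exp (real k0 + 1) + exp (t 1 * R))"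
        using I one_le_exp_iff[of "real k0 + 1"] by (intro mult_left_mono) (auto simp: add_increasing2)
      then show ?thesis using u(3)[of "{}" m] True by (simp add: C_def I_def)
    next
      case False
      define r where "r = Max (range (\<lambda>i. \<bar>real_of_int (m $ i)\<bar>))"
      have "r \<in> range (\<lambda>i. \<bar>real_of_int (m $ i)\<bar>)" unfolding r_def by (intro Max_in) auto
      then obtain i0 where i0: "r = \<bar>real_of_int (m $ i0)\<bar>" by blast
      have r_max: "\<bar>real_of_int (m $ i)\<bar> \<le> r" for i unfolding r_def by (intro Max_ge) auto
      obtain i where "m $ i \<noteq> 0" using False by (auto simp: vec_eq_iff)
      then have r1: "1 \<le> r" using r_max[of i] by linarith
      have le: "norm (lattice_vec m) \<le> real n * r"
      proof -
        have "norm (lattice_vec m) \<le> (\<Sum>i\<in>UNIV. \<bar>lattice_vec m $ i\<bar>)" by (rule norm_le_l1_cart)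
        also have "\<dots> \<le> (\<Sum>i\<in>(UNIV :: 'n set). r)" using r_max by (intro sum_mono) (simp add: lattice_vec_def)
        finally show ?thesis by (simp add: n_def)
      qed
      have ge: "r \<le> norm (lattice_vec m)"
        using component_le_norm_cart[of "lattice_vec m" i0] by (simp add: lattice_vec_def i0)
      have "?w \<le> \<Theta> r * (real n * r)"
        using le ge r1 by (intro mult_mono dec nonneg) auto
      then have w: "?w \<le> t r * r" by (simp add: t_def mult_ac)
      show ?thesis
      proof (cases "R \<le> r")
        case False
        then have "t r * r \<le> t 1 * R" using r1 t_nn t_dec[of 1 r] by (intro mult_mono) auto
        then have "1 \<le> exp (t 1 * R - ?w)" using w by simp
        then have "I * 1 \<le> I * exp (t 1 * R - ?w)" using I by (intro mult_left_mono) auto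
        also have "\<dots> \<le> C * exp (- ?w)" using I by (simp add: C_def exp_diff exp_minus field_simps)
        finally show ?thesis using u(3)[of "{}" m] by (simp add: I_def)
      next
        case True
        define N where "N = nat \<lfloor>t r * r\<rfloor>"
        have tr: "0 \<le> t r * r" "t r * r \<le> r"
          using t_nn[OF r1] R(2)[OF True] r1 mult_right_mono[of "t r" 1 r] by auto
        have N: "real N \<le> t r * r" "t r * r < real N + 1" using tr(1) by (auto simp: N_def)
        obtain c where c: "c < n" "e c = i0" using e by (auto simp: bij_betw_def) (metis UNIV_I imageE lessThan_iff)
        define J where "J = (\<lambda>j. j * n + c) ` {..<N - k0}"
        have inj: "inj_on (\<lambda>j. j * n + c) {..<N - k0}" using n by (auto simp: inj_on_def)
        have small: "norm (multiplier (v (j * n + c)) m) \<le> exp (- 1)" if j: "j < N - k0" for j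
        proof -
          define k where "k = real (Suc (j + k0))"
          have k: "1 \<le> k" "k \<le> real N" using j by (auto simp: k_def)
          have kr: "k \<le> r" using k N tr by simp
          have vk: "v (j * n + c) = \<rho> (j + k0) *\<^sub>R axis i0 1" using c by (simp add: v_def)
          have ip: "\<bar>lattice_vec m \<bullet> v (j * n + c)\<bar> = \<rho> (j + k0) * r"
            using \<rho>_nn[of "j + k0"] by (simp add: vk inner_axis lattice_vec_def abs_mult i0)
          have "exp 1 / pi * 1 \<le> exp 1 / pi * (t r * r / k)"
            using k N by (intro mult_left_mono) (auto simp: field_simps)
          also have "\<dots> \<le> exp 1 / pi * (t k * r / k)"
            using k kr r1 t_dec[OF k(1) kr] by (intro mult_left_mono divide_right_mono mult_right_mono) auto
          also have "\<dots> = \<rho> (j + k0) * r" by (simp add: \<rho>_def k_def)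
          finally have big: "exp 1 / pi \<le> \<bar>lattice_vec m \<bullet> v (j * n + c)\<bar>" by (simp add: ip)
          then have nz: "lattice_vec m \<bullet> v (j * n + c) \<noteq> 0"
            by (metis abs_zero divide_pos_pos exp_gt_zero not_le pi_gt_zero)
          have "norm (multiplier (v (j * n + c)) m) \<le> 1 / (pi * \<bar>lattice_vec m \<bullet> v (j * n + c)\<bar>)"
            by (rule norm_multiplier_le[OF nz])
          also have "\<dots> \<le> 1 / exp 1"
            using big nz by (intro divide_left_mono) (auto simp: field_simps zero_less_mult_iff)
          finally show ?thesis by (simp add: exp_minus inverse_eq_divide)
        qed
        have "norm (ft u m) \<le> I * (\<Prod>k\<in>J. norm (multiplier (v k) m))"
          using u(3)[of J m] by (simp add: J_def I_def)
        also have "\<dots> = I * (\<Prod>j<N - k0. norm (multiplier (v (j * n + c)) m))"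
          unfolding J_def by (subst prod.reindex[OF inj]) simp
        also have "\<dots> \<le> I * (\<Prod>j<N - k0. exp (- 1))"
          using I small by (intro mult_left_mono prod_mono) auto
        also have "\<dots> = I * exp (- real (N - k0))" by (simp add: exp_of_nat_mult[symmetric])
        also have "\<dots> \<le> I * exp (real k0 + 1 - ?w)"
          using I w N by (intro mult_left_mono) (auto simp: of_nat_diff_if)
        also have "\<dots> \<le> C * exp (- ?w)" using I by (simp add: C_def exp_diff exp_minus field_simps)
        finally show ?thesis .
      qed
    qed
  qed
qed

section \<open>Quasi-analytic Fourier series\<close>

text \<open>
The moment bounds allow termwise differentiation of any order, which makes the real part of the
trigonometric series a function to which the Denjoy--Carleman theorem applies.
\<close>

lemma trig_series_quasianalytic_Re:
  fixes c :: "nat \<Rightarrow> complex" and \<omega> :: "nat \<Rightarrow> real"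
  assumes sum: "\<And>k. summable (\<lambda>n. \<bar>\<omega> n\<bar> ^ k * norm (c n))"
    and bnd: "\<And>k. (\<Sum>n. \<bar>\<omega> n\<bar> ^ k * norm (c n)) \<le> A * (\<Prod>j<k. \<mu> j)"
    and pos: "\<And>j. 0 < \<mu> j" and mono: "\<And>i j. i \<le> j \<Longrightarrow> \<mu> i \<le> \<mu> j"
    and div: "\<not> summable (\<lambda>j. 1 / \<mu> j)"
    and \<epsilon>: "0 < \<epsilon>" and zero: "\<And>t. \<bar>t\<bar> < \<epsilon> \<Longrightarrow> (\<Sum>n. Re (c n * cis (\<omega> n * t))) = 0"
    and t: "0 \<le> t"
  shows "(\<Sum>n. Re (c n * cis (\<omega> n * t))) = 0"
proof -
  define d where "d = (\<lambda>k n t. Re (c n * (\<i> * of_real (\<omega> n)) ^ k * cis (\<omega> n * t)))"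
  define D where "D = (\<lambda>k t. \<Sum>n. d k n t)"
  have d_le: "\<bar>d k n t\<bar> \<le> \<bar>\<omega> n\<bar> ^ k * norm (c n)" for k n t
  proof -
    have "\<bar>d k n t\<bar> \<le> norm (c n * (\<i> * of_real (\<omega> n)) ^ k * cis (\<omega> n * t))"
      unfolding d_def by (rule abs_Re_le_cmod)
    then show ?thesis by (simp add: norm_mult norm_power mult.commute)
  qed
  have d_sum: "summable (\<lambda>n. d k n t)" for k t
    by (rule summable_comparison_test'[OF sum[of k], of 0]) (use d_le in auto)
  have d_der: "(d k n has_real_derivative d (Suc k) n t) (at t)" for k n t
  proof -
    define z where "z = c n * (\<i> * of_real (\<omega> n)) ^ k"
    have "((\<lambda>t. Re z * cos (\<omega> n * t) - Im z * sin (\<omega> n * t)) has_real_derivative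
       - (Re z * \<omega> n) * sin (\<omega> n * t) - (Im z * \<omega> n) * cos (\<omega> n * t)) (at t)"
      by (auto intro!: derivative_eq_intros)
    moreover have "d k n = (\<lambda>t. Re z * cos (\<omega> n * t) - Im z * sin (\<omega> n * t))"
      unfolding d_def z_def[symmetric] by (rule ext) simp
    moreover have "d (Suc k) n t = - (Re z * \<omega> n) * sin (\<omega> n * t) - (Im z * \<omega> n) * cos (\<omega> n * t)"
    proof -
      have zS: "c n * (\<i> * of_real (\<omega> n)) ^ Suc k = \<i> * of_real (\<omega> n) * z" by (simp add: z_def mult_ac)
      show ?thesis unfolding d_def zS by (simp add: algebra_simps)
    qed
    ultimately show ?thesis by simp
  qed
  have der: "(D k has_real_derivative D (Suc k) t) (at t)" for k t
  proof -
    have u: "uniformly_convergent_on UNIV (\<lambda>n x. \<Sum>i<n. d (Suc k) i x)"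
      by (rule Weierstrass_m_test'[OF _ sum[of "Suc k"]]) (use d_le[of "Suc k"] in auto)
    have "((\<lambda>x. \<Sum>n. d k n x) has_field_derivative (\<Sum>n. d (Suc k) n t)) (at t)"
      by (rule has_field_derivative_series'(2)[OF convex_UNIV d_der u UNIV_I d_sum]) simp
    then show ?thesis by (simp add: D_def[abs_def])
  qed
  have Dbnd: "\<bar>D k t\<bar> \<le> A * (\<Prod>j<k. \<mu> j)" for k t
  proof -
    have s: "summable (\<lambda>n. \<bar>d k n t\<bar>)"
      by (rule summable_comparison_test'[OF sum[of k], of 0]) (use d_le in auto)
    have "\<bar>D k t\<bar> \<le> (\<Sum>n. \<bar>d k n t\<bar>)" unfolding D_def by (rule summable_rabs[OF s])
    also have "\<dots> \<le> (\<Sum>n. \<bar>\<omega> n\<bar> ^ k * norm (c n))" by (intro suminf_le d_le s sum)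
    finally show ?thesis using bnd order_trans by blast
  qed
  have D0: "D 0 t = (\<Sum>n. Re (c n * cis (\<omega> n * t)))" for t by (simp add: D_def d_def)
  have flat: "\<bar>t\<bar> < \<epsilon> \<Longrightarrow> D k t = 0" for k t
  proof (induction k arbitrary: t)
    case 0 then show ?case using zero by (simp add: D0)
  next
    case (Suc k)
    have "((\<lambda>_. 0) has_real_derivative D (Suc k) t) (at t)"
    proof (rule has_field_derivative_transform_within_open[OF der])
      show "open {- \<epsilon><..<\<epsilon>}" "t \<in> {- \<epsilon><..<\<epsilon>}" using Suc.prems by auto
      show "\<And>x. x \<in> {- \<epsilon><..<\<epsilon>} \<Longrightarrow> D k x = 0" using Suc.IH by auto
    qed
    then show ?case using DERIV_const DERIV_unique by blast
  qed
  have "D 0 t = 0"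
    by (rule denjoy_carleman_bang[OF der Dbnd pos mono div _ t]) (use flat \<epsilon> in auto)
  then show ?thesis by (simp add: D0)
qed

lemma trig_series_quasianalytic:
  fixes c :: "nat \<Rightarrow> complex" and \<omega> :: "nat \<Rightarrow> real"
  assumes sum: "\<And>k. summable (\<lambda>n. \<bar>\<omega> n\<bar> ^ k * norm (c n))"
    and bnd: "\<And>k. (\<Sum>n. \<bar>\<omega> n\<bar> ^ k * norm (c n)) \<le> A * (\<Prod>j<k. \<mu> j)"
    and pos: "\<And>j. 0 < \<mu> j" and mono: "\<And>i j. i \<le> j \<Longrightarrow> \<mu> i \<le> \<mu> j"
    and div: "\<not> summable (\<lambda>j. 1 / \<mu> j)"
    and \<epsilon>: "0 < \<epsilon>" and zero: "\<And>t. \<bar>t\<bar> < \<epsilon> \<Longrightarrow> (\<Sum>n. c n * cis (\<omega> n * t)) = 0"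
    and t: "0 \<le> t"
  shows "(\<Sum>n. c n * cis (\<omega> n * t)) = 0"
proof -
  have s: "summable (\<lambda>n. c n * cis (\<omega> n * t))" for t
    using sum[of 0] by (intro summable_norm_cancel[of "\<lambda>n. c n * cis (\<omega> n * t)"]) (simp add: norm_mult)
  have R: "(\<Sum>n. Re (c n * cis (\<omega> n * t))) = Re (\<Sum>n. c n * cis (\<omega> n * t))"
    and I: "(\<Sum>n. Re ((- \<i> * c n) * cis (\<omega> n * t))) = Im (\<Sum>n. c n * cis (\<omega> n * t))" for t
  proof -
    show "(\<Sum>n. Re (c n * cis (\<omega> n * t))) = Re (\<Sum>n. c n * cis (\<omega> n * t))"
      by (rule bounded_linear.suminf[OF bounded_linear_Re s, symmetric])
    have "(\<Sum>n. Re ((- \<i> * c n) * cis (\<omega> n * t))) = (\<Sum>n. Im (c n * cis (\<omega> n * t)))"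
      by (intro suminf_cong) (simp add: algebra_simps)
    also have "\<dots> = Im (\<Sum>n. c n * cis (\<omega> n * t))"
      by (rule bounded_linear.suminf[OF bounded_linear_Im s, symmetric])
    finally show "(\<Sum>n. Re ((- \<i> * c n) * cis (\<omega> n * t))) = Im (\<Sum>n. c n * cis (\<omega> n * t))" .
  qed
  have "(\<Sum>n. Re (c n * cis (\<omega> n * t))) = 0"
    by (rule trig_series_quasianalytic_Re[OF sum bnd pos mono div \<epsilon> _ t]) (simp_all only: R zero zero_complex.sel)
  moreover have "(\<Sum>n. Re ((- \<i> * c n) * cis (\<omega> n * t))) = 0"
    by (rule trig_series_quasianalytic_Re[OF _ _ pos mono div \<epsilon> _ t, where A = A])
       (use sum bnd zero in \<open>simp_all only: I zero_complex.sel norm_mult norm_minus_cancel norm_ii mult_1_left\<close>)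
  ultimately show ?thesis by (simp only: R I complex_eq_iff zero_complex.sel)
qed

definition lattice_series :: "(int ^ 'n \<Rightarrow> complex) \<Rightarrow> real ^ 'n::finite \<Rightarrow> complex" where
  "lattice_series c x = (\<Sum>k. c (lattice_enum k) * echar (lattice_enum k) x)"

abbreviation lattice_summable :: "(int ^ 'n::finite \<Rightarrow> complex) \<Rightarrow> bool" where
  "lattice_summable c \<equiv> summable (\<lambda>k. norm (c (lattice_enum k)))"

text \<open>
Restricting the series to the line through \<open>p\<close> and \<open>x\<close> gives a function of one variable whose
frequencies are at most \<open>a \<bar>m\<bar>\<close>.  Of the decay \<open>exp (-2 \<surd>\<bar>m\<bar>)\<close>, one half is spent on bounding
powers of \<open>\<bar>m\<bar>\<close> by the weights, and the other half makes the sum over the lattice converge.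
\<close>

lemma lattice_series_quasianalytic:
  fixes c :: "int ^ 'n::finite \<Rightarrow> complex" and \<Theta> :: "real \<Rightarrow> real"
  assumes pos: "\<And>r. 1 \<le> r \<Longrightarrow> 0 < \<Theta> r"
    and dec: "\<And>r s. 1 \<le> r \<Longrightarrow> r \<le> s \<Longrightarrow> \<Theta> s \<le> \<Theta> r"
    and div: "\<not> summable (\<lambda>k. \<Theta> (real (Suc k)) / real (Suc k))"
    and decay: "\<And>m. norm (c m) \<le> C * exp (- (\<Theta> (norm (lattice_vec m)) * norm (lattice_vec m)) - 2 * sqrt (norm (lattice_vec m)))"
    and \<delta>: "0 < \<delta>" and zero: "\<And>x. x \<in> ball p \<delta> \<Longrightarrow> lattice_series c x = 0"
  shows "lattice_series c x = 0"
proof -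
  define v where "v = x - p"
  \<comment> \<open>The summand 1 keeps \<open>a\<close> positive when \<open>x = p\<close>.\<close>
  define a where "a = 2 * pi * (norm v + 1)"
  have a: "0 < a" unfolding a_def by (intro mult_pos_pos add_nonneg_pos) auto
  define \<omega> where "\<omega> = (\<lambda>n. 2 * pi * (lattice_vec (lattice_enum n) \<bullet> v))"
  define c' where "c' = (\<lambda>n. c (lattice_enum n) * echar (lattice_enum n) p)"
  define \<mu> where "\<mu> = (\<lambda>j. a * weight \<Theta> j)"
  define g where "g = (\<lambda>n. exp (- sqrt (norm (lattice_vec (lattice_enum n :: int ^ 'n)))))"
  have g: "summable g" unfolding g_def by (rule summable_lattice)
  have C: "0 \<le> C" using norm_ge_zero[of "c 0"] decay[of 0] by (simp del: norm_ge_zero)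
  have wpos: "0 < weight \<Theta> j" for j
    unfolding weight_def by (intro divide_pos_pos pos one_le_power) auto
  obtain B where B: "1 \<le> B" "\<And>k r. 1 \<le> r \<Longrightarrow> r ^ k \<le> B * (\<Prod>j<k. weight \<Theta> j) * exp (\<Theta> r * r + sqrt r)"
    using power_le_weights[of \<Theta>] pos dec by blast
  have term_le: "\<bar>\<omega> n\<bar> ^ k * norm (c' n) \<le> B * C * (\<Prod>j<k. \<mu> j) * g n" for k n
  proof -
    define m :: "int ^ 'n" where "m = lattice_enum n"
    define r where "r = norm (lattice_vec m)"
    have "\<bar>\<omega> n\<bar> \<le> a * r"
    proof -
      have "\<bar>lattice_vec m \<bullet> v\<bar> \<le> r * (norm v + 1)"
        using Cauchy_Schwarz_ineq2[of "lattice_vec m" v] by (simp add: r_def distrib_left add_increasing2)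
      then have "2 * pi * \<bar>lattice_vec m \<bullet> v\<bar> \<le> 2 * pi * (r * (norm v + 1))" by (intro mult_left_mono) auto
      then show ?thesis unfolding \<omega>_def a_def m_def[symmetric] by (simp only: abs_mult mult_ac) simp
    qed
    moreover have "norm (c' n) \<le> C * exp (- (\<Theta> r * r) - 2 * sqrt r)"
      using decay[of m] by (simp add: c'_def norm_mult m_def r_def)
    ultimately have "\<bar>\<omega> n\<bar> ^ k * norm (c' n) \<le> (a * r) ^ k * (C * exp (- (\<Theta> r * r) - 2 * sqrt r))"
      using a by (intro mult_mono power_mono) (auto simp: r_def)
    also have "\<dots> = C * a ^ k * exp (- sqrt r) * (r ^ k * exp (- (\<Theta> r * r + sqrt r)))"
      by (simp add: power_mult_distrib exp_add[symmetric] exp_diff exp_minus field_simps flip: exp_add)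
    also have "\<dots> \<le> C * a ^ k * exp (- sqrt r) * (B * (\<Prod>j<k. weight \<Theta> j))"
    proof (rule mult_left_mono)
      show "r ^ k * exp (- (\<Theta> r * r + sqrt r)) \<le> B * (\<Prod>j<k. weight \<Theta> j)"
      proof (cases "m = 0")
        case True
        then show ?thesis using B(1) less_imp_le[OF wpos]
          by (cases k) (auto simp: r_def intro!: mult_nonneg_nonneg prod_nonneg)
      next
        case False
        then have "1 \<le> r" unfolding r_def by (rule norm_lattice_vec_ge_1)
        have "x * exp (- y) \<le> w" if "x \<le> w * exp y" for x y w :: real
          using that by (simp add: exp_minus field_simps)
        from this[OF B(2)[OF \<open>1 \<le> r\<close>, of k]] show ?thesis .
      qed
    qed (use C a in auto)
    also have "\<dots> = B * C * (\<Prod>j<k. \<mu> j) * g n"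
      by (simp add: \<mu>_def prod.distrib g_def r_def m_def mult_ac)
    finally show ?thesis .
  qed
  have sum: "summable (\<lambda>n. \<bar>\<omega> n\<bar> ^ k * norm (c' n))" for k
    by (rule summable_comparison_test'[OF summable_mult[OF g, of "B * C * (\<Prod>j<k. \<mu> j)"], of 0])
       (use term_le[of _ k] in auto)
  have line: "lattice_series c (p + t *\<^sub>R v) = (\<Sum>n. c' n * cis (\<omega> n * t))" for t
    unfolding lattice_series_def c'_def \<omega>_def echar_add
    by (intro suminf_cong) (simp add: echar_def mult_ac)
  have "(\<Sum>n. c' n * cis (\<omega> n * 1)) = 0"
  proof (rule trig_series_quasianalytic[OF sum])
    show "(\<Sum>n. \<bar>\<omega> n\<bar> ^ k * norm (c' n)) \<le> (B * C * suminf g) * (\<Prod>j<k. \<mu> j)" for k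
    proof -
      have "(\<Sum>n. \<bar>\<omega> n\<bar> ^ k * norm (c' n)) \<le> (\<Sum>n. B * C * (\<Prod>j<k. \<mu> j) * g n)"
        by (intro suminf_le term_le sum summable_mult g)
      also have "\<dots> = B * C * (\<Prod>j<k. \<mu> j) * suminf g" by (rule suminf_mult[OF g])
      finally show ?thesis by (simp add: mult_ac)
    qed
    show "0 < \<mu> j" for j using a wpos by (simp add: \<mu>_def)
    show "\<mu> i \<le> \<mu> j" if "i \<le> j" for i j
      unfolding \<mu>_def using a by (intro mult_left_mono weight_mono pos dec that) auto
    show "\<not> summable (\<lambda>j. 1 / \<mu> j)"
    proof
      assume "summable (\<lambda>j. 1 / \<mu> j)"
      then have "summable (\<lambda>j. a * (1 / \<mu> j))" by (rule summable_mult)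
      then have "summable (\<lambda>j. 1 / weight \<Theta> j)" using a by (simp add: \<mu>_def)
      with not_summable_inverse_weight[of \<Theta>, OF pos dec div] show False by blast
    qed
    show "0 < \<delta> / (norm v + 1)" using \<delta> by (intro divide_pos_pos add_nonneg_pos) auto
    show "(\<Sum>n. c' n * cis (\<omega> n * t)) = 0" if "\<bar>t\<bar> < \<delta> / (norm v + 1)" for t
    proof -
      have "\<bar>t\<bar> * norm v \<le> \<bar>t\<bar> * (norm v + 1)" by (intro mult_left_mono) auto
      also have "\<dots> < \<delta>" using that by (simp add: pos_less_divide_eq add_nonneg_pos)
      finally show ?thesis unfolding line[symmetric] by (intro zero) (simp add: dist_norm)
    qed
  qed simp
  then show ?thesis using line[of 1] by (simp add: v_def)
qed

section \<open>Inversion for translated bumps\<close>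

lemma integral_trig_series:
  fixes F :: "real ^ 'n::finite \<Rightarrow> complex" and c :: "nat \<Rightarrow> complex" and g :: "nat \<Rightarrow> int ^ 'n"
  assumes F: "integrable (lebesgue_on unit_cube) F" and c: "summable (\<lambda>k. norm (c k))"
  shows "integrable (lebesgue_on unit_cube) (\<lambda>y. F y * (\<Sum>k. c k * echar (g k) y))"
    and "(LINT y | lebesgue_on unit_cube. F y * (\<Sum>k. c k * echar (g k) y))
      = (\<Sum>k. c k * (LINT y | lebesgue_on unit_cube. F y * echar (g k) y))"
proof -
  have s: "summable (\<lambda>k. c k * echar (g k) y)" for y
    by (rule summable_norm_cancel) (use c in \<open>simp add: norm_mult\<close>)
  have eq: "F y * (\<Sum>k. c k * echar (g k) y) = (\<Sum>k. F y * (c k * echar (g k) y))" for y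
    by (rule suminf_mult[OF s, symmetric])
  have int: "integrable (lebesgue_on unit_cube) (\<lambda>y. F y * (c k * echar (g k) y))" for k
    by (intro integrable_cube_mult F continuous_intros)
  have sn: "summable (\<lambda>k. norm (F y * (c k * echar (g k) y)))" for y
    using summable_mult[OF c, of "norm (F y)"] by (simp add: norm_mult mult.assoc)
  have si: "summable (\<lambda>k. LINT y | lebesgue_on unit_cube. norm (F y * (c k * echar (g k) y)))"
  proof -
    have "(LINT y | lebesgue_on unit_cube. norm (F y * (c k * echar (g k) y))) =
        norm (c k) * (LINT y | lebesgue_on unit_cube. norm (F y))" for k
      by (simp add: norm_mult mult.commute)
    then show ?thesis using summable_mult2[OF c] by simp
  qed
  show "integrable (lebesgue_on unit_cube) (\<lambda>y. F y * (\<Sum>k. c k * echar (g k) y))"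
    unfolding eq by (intro integrable_suminf int AE_I2 sn si)
  have "(LINT y | lebesgue_on unit_cube. F y * (\<Sum>k. c k * echar (g k) y))
      = (\<Sum>k. LINT y | lebesgue_on unit_cube. F y * (c k * echar (g k) y))"
    unfolding eq by (intro integral_suminf int AE_I2 sn si)
  also have "\<dots> = (\<Sum>k. c k * (LINT y | lebesgue_on unit_cube. F y * echar (g k) y))"
  proof (intro suminf_cong)
    fix k
    show "(LINT y | lebesgue_on unit_cube. F y * (c k * echar (g k) y)) = c k * (LINT y | lebesgue_on unit_cube. F y * echar (g k) y)"
      by (subst integral_mult_right_zero[symmetric]) (simp add: mult_ac)
  qed
  finally show "(LINT y | lebesgue_on unit_cube. F y * (\<Sum>k. c k * echar (g k) y))
      = (\<Sum>k. c k * (LINT y | lebesgue_on unit_cube. F y * echar (g k) y))" .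
qed

lemma integrable_cube_continuous:
  fixes g :: "real ^ 'n::finite \<Rightarrow> complex"
  assumes "continuous_on UNIV g"
  shows "integrable (lebesgue_on unit_cube) g"
proof -
  interpret finite_measure "lebesgue_on (unit_cube :: (real ^ 'n) set)" by (rule finite_measure_cube)
  show ?thesis using integrable_cube_mult[of "\<lambda>_. 1" g] assms by simp
qed

lemma lattice_series_diff:
  "lattice_series c (x - y) = (\<Sum>k. (c (lattice_enum k) * echar (lattice_enum k) x) * echar (- lattice_enum k) y)"
  unfolding lattice_series_def
  by (intro suminf_cong) (simp add: diff_conv_add_uminus echar_add echar_minus del: add_uminus_conv_diff)

lemma suminf_lattice_single:
  fixes m :: "int ^ 'n::finite" and h :: "int ^ 'n \<Rightarrow> complex"
  assumes "\<And>k. k \<noteq> m \<Longrightarrow> h k = 0"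
  shows "(\<Sum>j. h (lattice_enum j)) = h m"
proof -
  obtain i where i: "lattice_enum i = m" using bij_lattice_enum by (metis bij_pointE)
  have "h (lattice_enum j) = 0" if "j \<noteq> i" for j
    using that i bij_lattice_enum assms by (metis bij_def injD)
  then have "(\<Sum>j. h (lattice_enum j)) = (\<Sum>j\<in>{i}. h (lattice_enum j))" by (intro suminf_finite) auto
  then show ?thesis by (simp add: i)
qed

lemma lattice_series_coeff:
  fixes c :: "int ^ 'n::finite \<Rightarrow> complex"
  assumes c: "lattice_summable c"
  shows "(LINT y | lebesgue_on unit_cube. echar (- m) y * lattice_series c y) = c m"
proof -
  have "(LINT y | lebesgue_on unit_cube. echar (- m) y * lattice_series c y)
      = (\<Sum>j. c (lattice_enum j) * (LINT y | lebesgue_on unit_cube. echar (- m) y * echar (lattice_enum j) y))"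
    unfolding lattice_series_def by (intro integral_trig_series c integrable_cube_continuous continuous_intros)
  also have "\<dots> = (\<Sum>j. (\<lambda>k. c k * (if - m + k = 0 then 1 else 0)) (lattice_enum j))"
    by (simp only: echar_add_left[symmetric] integral_echar)
  also have "\<dots> = c m" by (subst suminf_lattice_single[where m = m]) auto
  finally show ?thesis .
qed

lemma integral_cube_bump:
  fixes w :: "real ^ 'n::finite \<Rightarrow> complex"
  assumes w: "w \<in> borel_measurable borel" and "\<And>y. y \<notin> unit_cube \<Longrightarrow> w y = 0"
  shows "(LINT y | lebesgue_on unit_cube. w y) = (LINT y | lborel. w y)"
  unfolding integral_cube_lborel[OF w]
  by (intro Bochner_Integration.integral_cong refl) (use assms in \<open>auto simp: indicator_def\<close>)

text \<open>
Fourier inversion.  As a function of \<open>y\<close>, both sides are integrable on the cube and have the same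
Fourier coefficients, so that the uniqueness theorem applies.
\<close>

lemma bump_inversion:
  fixes u :: "real ^ 'n::finite \<Rightarrow> real"
  assumes u: "bump B R u" and sub: "cball x R \<subseteq> unit_cube" and s: "lattice_summable (ft u)"
  shows "AE y in lebesgue_on unit_cube. of_real (u (x - y)) = lattice_series (ft u) (x - y)"
proof -
  note [measurable] = bump_measurable[OF u]
  have out: "u (x - y) = 0" if "y \<notin> unit_cube" for y
  proof -
    have "y \<notin> cball x R" using that sub by blast
    then show ?thesis using u by (auto simp: bump_def dist_norm)
  qed
  note ser = lattice_series_diff[of "ft u" x]
  have s': "summable (\<lambda>k. norm (ft u (lattice_enum k) * echar (lattice_enum k) x))"
    using s by (simp add: norm_mult)
  let ?F = "\<lambda>y. complex_of_real (u (x - y)) - lattice_series (ft u) (x - y)"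
  have cu: "continuous_on UNIV (\<lambda>y. complex_of_real (u (x - y)))"
    using bump_continuous[OF u, of UNIV] by (intro continuous_intros continuous_on_compose2[OF bump_continuous[OF u, of UNIV]]) auto
  have i1: "integrable (lebesgue_on unit_cube) (\<lambda>y. complex_of_real (u (x - y)))"
    by (rule integrable_cube_continuous[OF cu])
  have i2: "integrable (lebesgue_on unit_cube) (\<lambda>y. lattice_series (ft u) (x - y))"
    using integral_trig_series(1)[OF integrable_cube_continuous[OF continuous_on_const[of UNIV 1]] s', of "\<lambda>k. - lattice_enum k"]
    by (simp add: ser)
  have i: "integrable (lebesgue_on unit_cube) ?F" by (intro Bochner_Integration.integrable_diff i1 i2)
  have "AE y in lebesgue_on unit_cube. ?F y = 0"
  proof (rule fourier_uniqueness_cube[OF i])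
    fix m :: "int ^ 'n"
    have "(LINT y | lebesgue_on unit_cube. of_real (u (x - y)) * echar m y) = (LINT y | lborel. of_real (u (x - y)) * echar m y)"
      by (rule integral_cube_bump) (use out in auto)
    also have "\<dots> = (LINT y | distr lborel borel (\<lambda>z. x + (-1) *\<^sub>R z). of_real (u (x - y)) * echar m y)"
      using lborel_affine[of "-1" x] by (simp add: density_1)
    also have "\<dots> = (LINT z | lborel. of_real (u (x - (x + (-1) *\<^sub>R z))) * echar m (x + (-1) *\<^sub>R z))"
      by (rule integral_distr) measurable
    also have "\<dots> = (LINT z | lborel. echar m x * (of_real (u z) * echar (- m) z))"
      by (simp add: diff_conv_add_uminus echar_add echar_minus mult_ac del: add_uminus_conv_diff)
    also have "\<dots> = echar m x * ft u m" by (simp add: ft_def)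
    finally have e1: "(LINT y | lebesgue_on unit_cube. of_real (u (x - y)) * echar m y) = echar m x * ft u m" .
    have "(LINT y | lebesgue_on unit_cube. lattice_series (ft u) (x - y) * echar m y)
       = (LINT y | lebesgue_on unit_cube. echar m y * (\<Sum>k. (ft u (lattice_enum k) * echar (lattice_enum k) x) * echar (- lattice_enum k) y))"
      by (simp add: ser mult.commute)
    also have "\<dots> = (\<Sum>k. (ft u (lattice_enum k) * echar (lattice_enum k) x) * (LINT y | lebesgue_on unit_cube. echar m y * echar (- lattice_enum k) y))"
      by (intro integral_trig_series s' integrable_cube_continuous continuous_intros)
    also have "\<dots> = (\<Sum>k. (\<lambda>l. (ft u l * echar l x) * (if m + - l = 0 then 1 else 0)) (lattice_enum k))"
      by (simp only: echar_add_left[symmetric] integral_echar)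
    also have "\<dots> = ft u m * echar m x" by (subst suminf_lattice_single[where m = m]) auto
    finally have e2: "(LINT y | lebesgue_on unit_cube. lattice_series (ft u) (x - y) * echar m y) = ft u m * echar m x" .
    have "(LINT y | lebesgue_on unit_cube. ?F y * echar m y)
       = (LINT y | lebesgue_on unit_cube. of_real (u (x - y)) * echar m y) - (LINT y | lebesgue_on unit_cube. lattice_series (ft u) (x - y) * echar m y)"
      unfolding left_diff_distrib
      by (intro Bochner_Integration.integral_diff integrable_cube_mult i1 i2 continuous_intros)
    also have "\<dots> = 0" unfolding e1 e2 by (simp add: mult.commute)
    finally show "(LINT y | lebesgue_on unit_cube. ?F y * echar m y) = 0" .
  qed
  then show ?thesis by simp
qed

lemma norm_cis_minus_1: "norm (cis t - 1) \<le> \<bar>t\<bar>"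
  using dist_exp_i_1[of t] abs_sin_x_le_abs_x[of "t / 2"] by (simp add: cis_conv_exp)

text \<open>
On a support so small that the character at \<open>a\<close> differs from 1 by less than 1, the Fourier transform
at \<open>a\<close> differs from the integral of \<open>u\<close> by less than that integral.
\<close>

lemma ft_neq_0:
  fixes u :: "real ^ 'n::finite \<Rightarrow> real"
  assumes u: "bump B R u" and I: "0 < (LINT x | lborel. u x)" and small: "2 * pi * (norm (lattice_vec a) * R) < 1"
  shows "ft u a \<noteq> 0"
proof -
  let ?I = "LINT x | lborel. u x"
  have int: "integrable lborel (\<lambda>x. of_real (u x) * echar (- a) x)"
    by (intro integrable_bump[OF u]) auto
  have intu: "integrable lborel u" by (rule integrable_bump_real[OF u])
  have "norm (ft u a - of_real ?I) = norm (LINT x | lborel. of_real (u x) * echar (- a) x - of_real (u x))"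
    unfolding ft_def using int intu by simp
  also have "\<dots> \<le> (LINT x | lborel. norm (of_real (u x) * echar (- a) x - of_real (u x)))"
    by (rule integral_norm_bound)
  also have "\<dots> \<le> (LINT x | lborel. (2 * pi * (norm (lattice_vec a) * R)) * u x)"
  proof (rule integral_mono)
    show "integrable lborel (\<lambda>x. norm (of_real (u x) * echar (- a) x - of_real (u x)))"
      using int intu by auto
    show "integrable lborel (\<lambda>x. (2 * pi * (norm (lattice_vec a) * R)) * u x)" using intu by auto
    fix x :: "real ^ 'n"
    have "of_real (u x) * echar (- a) x - of_real (u x) = of_real (u x) * (echar (- a) x - 1)"
      by (simp add: right_diff_distrib)
    then have "norm (of_real (u x) * echar (- a) x - of_real (u x)) = u x * norm (echar (- a) x - 1)"
      using u by (simp add: bump_def norm_mult)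
    also have "\<dots> \<le> u x * (2 * pi * (norm (lattice_vec a) * R))"
    proof (cases "norm x \<le> R")
      case True
      have "norm (echar (- a) x - 1) \<le> 2 * pi * \<bar>lattice_vec a \<bullet> x\<bar>"
        using norm_cis_minus_1[of "2 * pi * (lattice_vec (- a) \<bullet> x)"] by (simp add: echar_def lattice_vec_minus abs_mult)
      also have "\<dots> \<le> 2 * pi * (norm (lattice_vec a) * R)"
        using Cauchy_Schwarz_ineq2[of "lattice_vec a" x] mult_left_mono[OF True norm_ge_zero[of "lattice_vec a"]]
        by (intro mult_left_mono) auto
      finally show ?thesis using u by (intro mult_left_mono) (auto simp: bump_def)
    qed (use u in \<open>auto simp: bump_def\<close>)
    finally show "norm (of_real (u x) * echar (- a) x - of_real (u x)) \<le> (2 * pi * (norm (lattice_vec a) * R)) * u x"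
      by (simp add: mult.commute)
  qed
  also have "\<dots> = (2 * pi * (norm (lattice_vec a) * R)) * ?I" by simp
  also have "\<dots> < ?I" using small I by simp
  finally have "norm (ft u a - of_real ?I) < ?I" .
  then show ?thesis using I by auto
qed

section \<open>The vanishing theorem and its converse\<close>

lemma torus_open_contains_ball:
  fixes U :: "(complex ^ 'n::finite) set"
  assumes U: "openin (top_of_set torus) U" "U \<noteq> {}"
  obtains p :: "real ^ 'n" and \<delta> where "0 < \<delta>" "ball p (2 * \<delta>) \<subseteq> box 0 (vec 1)"
    "torus_point ` ball p (2 * \<delta>) \<subseteq> U"
proof -
  obtain T where T: "open T" "U = torus \<inter> T" using U(1) by (auto simp: openin_open)
  obtain z where z: "z \<in> torus" "z \<in> T" using U(2) T by auto
  then obtain x where x: "z = torus_point x" "x \<in> unit_cube"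
    unfolding torus_eq by (auto simp: mem_unit_cube)
  define V where "V = (torus_point -` T :: (real ^ 'n) set)"
  have "open V" unfolding V_def by (intro open_vimage T continuous_on_torus_point)
  have ne: "box 0 (vec 1 :: real ^ 'n) \<noteq> {}"
    using interval_ne_empty_cart(2)[of "0 :: real ^ 'n" "vec 1"] by simp
  have "x \<in> V \<inter> closure (box 0 (vec 1))"
    unfolding closure_box[OF ne] using x z by (simp add: V_def unit_cube_def)
  then have "V \<inter> box 0 (vec 1) \<noteq> {}" using open_Int_closure_eq_empty[OF \<open>open V\<close>] by blast
  then obtain p where "p \<in> V \<inter> box 0 (vec 1)" by blast
  then obtain e where e: "0 < e" "ball p e \<subseteq> V \<inter> box 0 (vec 1)"
    using open_contains_ball[of "V \<inter> box 0 (vec 1)"] \<open>open V\<close> by (meson open_Int open_box)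
  show ?thesis
    by (rule that[of "e / 2" p]) (use e in \<open>auto simp: V_def T torus_point_in_torus\<close>)
qed

lemma lattice_summable_decay:
  fixes c :: "int ^ 'n::finite \<Rightarrow> complex"
  assumes "\<And>m. norm (c m) \<le> C * exp (- sqrt (norm (lattice_vec m)))"
  shows "lattice_summable c"
  by (rule summable_comparison_test'[OF summable_mult[OF summable_lattice, of C], of 0]) (use assms in auto)

text \<open>
This is part (a), one coefficient at a time.  The series \<open>c\<close> with coefficients \<open>f^(m) u^(m)\<close> is the
convolution of \<open>f\<close> with a bump \<open>u\<close> of small support, so it vanishes near \<open>p\<close>, where \<open>f\<close> vanishes on
a larger ball.  The decay of \<open>u^\<close> supplies the regularity that the bound on \<open>f^\<close> alone does not
guarantee.  By quasi-analyticity the series is 0 everywhere, hence so are its coefficients, and \<open>u\<close> is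
chosen such that \<open>u^(a) \<noteq> 0\<close>.
\<close>

lemma fourier_coeff_eq_0:
  fixes f :: "complex ^ 'n::finite \<Rightarrow> complex" and \<Theta> :: "real \<Rightarrow> real"
  assumes L1: "torus_L1 f"
    and pos: "\<And>r. 1 \<le> r \<Longrightarrow> 0 < \<Theta> r"
    and dec: "\<And>r s. 1 \<le> r \<Longrightarrow> r \<le> s \<Longrightarrow> \<Theta> s \<le> \<Theta> r"
    and div: "\<not> summable (\<lambda>k. \<Theta> (real (Suc k)) / real (Suc k))"
    and decay: "\<And>m. norm (fourier_coeff f m) \<le> C * exp (- (\<Theta> (norm (lattice_vec m)) * norm (lattice_vec m)))"
    and \<delta>: "0 < \<delta>" and sub: "ball p (2 * \<delta>) \<subseteq> box 0 (vec 1)"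
    and zero: "AE x in lebesgue_on unit_cube. x \<in> ball p (2 * \<delta>) \<longrightarrow> f (torus_point x) = 0"
  shows "fourier_coeff f a = 0"
proof -
  \<comment> \<open>The radius must keep the convolution local and must ensure \<open>ft u a \<noteq> 0\<close>.\<close>
  define \<epsilon> where "\<epsilon> = min (\<delta> / 2) (1 / (4 * pi * (norm (lattice_vec a) + 1)))"
  have a1: "0 < norm (lattice_vec a) + 1" by (simp add: add_nonneg_pos)
  have \<epsilon>: "0 < \<epsilon>" "\<epsilon> < \<delta>" using \<delta> a1 by (auto simp: \<epsilon>_def)
  have \<epsilon>a: "2 * pi * (norm (lattice_vec a) * \<epsilon>) < 1"
  proof -
    have "2 * pi * (norm (lattice_vec a) * \<epsilon>) \<le> 2 * pi * ((norm (lattice_vec a) + 1) * (1 / (4 * pi * (norm (lattice_vec a) + 1))))"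
      using \<epsilon> by (intro mult_left_mono mult_mono) (auto simp: \<epsilon>_def)
    also have "\<dots> = 1 / 2"
    proof -
      have "y * (1 / (4 * pi * y)) = 1 / (4 * pi)" if "0 < y" for y :: real using that by simp
      from this[OF a1] show ?thesis by simp
    qed
    finally show ?thesis by simp
  qed
  have sqrt_sum: "summable (\<lambda>k. (2 / sqrt (real (Suc k))) / real (Suc k))"
  proof (rule summable_comparison_test_bigo)
    show "(\<lambda>k. (2 / sqrt (real (Suc k))) / real (Suc k)) \<in> O(\<lambda>k. real k powr (- 3 / 2))" by real_asymp
    show "summable (\<lambda>k. norm (real k powr (- 3 / 2)))" by (simp add: summable_real_powr_iff)
  qed
  obtain u :: "real ^ 'n \<Rightarrow> real" and B C' where u: "bump B \<epsilon> u" "0 < (LINT x | lborel. u x)"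
    and u_decay: "\<And>m. norm (ft u m) \<le> C' * exp (- (2 / sqrt (norm (lattice_vec m)) * norm (lattice_vec m)))"
    by (rule ingham_bump[of "\<lambda>r. 2 / sqrt r" \<epsilon>]) (use \<epsilon> sqrt_sum in \<open>auto intro!: divide_left_mono\<close>)
  have u_decay: "norm (ft u m) \<le> C' * exp (- 2 * sqrt (norm (lattice_vec m)))" for m
  proof -
    have "2 / sqrt r * r = 2 * sqrt r" if "0 \<le> r" for r
      using real_div_sqrt[OF that] by (metis times_divide_eq_left times_divide_eq_right)
    from this[OF norm_ge_zero[of "lattice_vec m"]] show ?thesis using u_decay[of m] by simp
  qed
  have C: "0 \<le> C" "0 \<le> C'"
    using order_trans[OF norm_ge_zero decay[of 0]] order_trans[OF norm_ge_zero u_decay[of 0]] by auto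
  have sum_u: "lattice_summable (ft u)"
  proof (rule lattice_summable_decay)
    fix m :: "int ^ 'n"
    have "C' * exp (- 2 * sqrt (norm (lattice_vec m))) \<le> C' * exp (- sqrt (norm (lattice_vec m)))"
      using C by (intro mult_left_mono) auto
    with u_decay[of m] show "norm (ft u m) \<le> C' * exp (- sqrt (norm (lattice_vec m)))" by linarith
  qed
  define c where "c = (\<lambda>m. fourier_coeff f m * ft u m)"
  have c_decay: "norm (c m) \<le> (C * C') * exp (- (\<Theta> (norm (lattice_vec m)) * norm (lattice_vec m)) - 2 * sqrt (norm (lattice_vec m)))" for m
  proof -
    have "norm (c m) \<le> (C * exp (- (\<Theta> (norm (lattice_vec m)) * norm (lattice_vec m)))) * (C' * exp (- 2 * sqrt (norm (lattice_vec m))))"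
      unfolding c_def norm_mult using C by (intro mult_mono decay u_decay) auto
    also have "\<dots> = (C * C') * exp (- (\<Theta> (norm (lattice_vec m)) * norm (lattice_vec m)) - 2 * sqrt (norm (lattice_vec m)))"
      by (simp add: exp_diff exp_minus field_simps)
    finally show ?thesis .
  qed
  have F: "integrable (lebesgue_on unit_cube) (\<lambda>x. f (torus_point x))" using L1 by (simp add: torus_L1_def)
  have near: "lattice_series c x = 0" if x: "x \<in> ball p \<delta>" for x
  proof -
    have xsub: "cball x \<epsilon> \<subseteq> ball p (2 * \<delta>)"
    proof
      fix y assume "y \<in> cball x \<epsilon>"
      then have "dist p y < \<delta> + \<delta>" using x \<epsilon> dist_triangle[of p y x] by auto
      then show "y \<in> ball p (2 * \<delta>)" by simp
    qed
    have "cball x \<epsilon> \<subseteq> unit_cube"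
      using xsub sub box_subset_cbox[of 0 "vec 1 :: real ^ 'n"] by (auto simp: unit_cube_def)
    from bump_inversion[OF u(1) this sum_u] zero
    have ae: "AE y in lebesgue_on unit_cube. f (torus_point y) * lattice_series (ft u) (x - y) = 0"
    proof eventually_elim
      case (elim y)
      show ?case
      proof (cases "y \<in> ball p (2 * \<delta>)")
        case False
        then have "y \<notin> cball x \<epsilon>" using xsub by blast
        then have "u (x - y) = 0" using u(1) by (auto simp: bump_def dist_norm)
        then show ?thesis using elim(1) by simp
      qed (use elim in auto)
    qed
    note ser = lattice_series_diff[of "ft u" x]
    have s': "summable (\<lambda>k. norm (ft u (lattice_enum k) * echar (lattice_enum k) x))"
      using sum_u by (simp add: norm_mult)
    note I = integral_trig_series[OF F s', of "\<lambda>k. - lattice_enum k", folded ser]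
    have "lattice_series c x = (\<Sum>k. (ft u (lattice_enum k) * echar (lattice_enum k) x) * fourier_coeff f (lattice_enum k))"
      unfolding lattice_series_def c_def by (intro suminf_cong) (simp add: mult_ac)
    also have "\<dots> = (LINT y | lebesgue_on unit_cube. f (torus_point y) * lattice_series (ft u) (x - y))"
      unfolding I(2) fourier_coeff_eq ..
    also have "\<dots> = (LINT y :: real ^ 'n | lebesgue_on unit_cube. 0)"
      by (rule integral_cong_AE) (use I(1) ae in auto)
    finally show ?thesis by simp
  qed
  have all: "lattice_series c x = 0" for x
    by (rule lattice_series_quasianalytic[OF pos dec div c_decay \<delta> near])
  have "lattice_summable c"
  proof (rule lattice_summable_decay)
    fix m :: "int ^ 'n"
    have "0 \<le> \<Theta> (norm (lattice_vec m)) * norm (lattice_vec m)"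
      using pos[OF norm_lattice_vec_ge_1[of m]] by (cases "m = 0") auto
    have "(C * C') * exp (- (\<Theta> (norm (lattice_vec m)) * norm (lattice_vec m)) - 2 * sqrt (norm (lattice_vec m)))
        \<le> (C * C') * exp (- sqrt (norm (lattice_vec m)))"
    proof (intro mult_left_mono)
      show "exp (- (\<Theta> (norm (lattice_vec m)) * norm (lattice_vec m)) - 2 * sqrt (norm (lattice_vec m)))
          \<le> exp (- sqrt (norm (lattice_vec m)))"
        using \<open>0 \<le> \<Theta> (norm (lattice_vec m)) * norm (lattice_vec m)\<close> real_sqrt_ge_zero[OF norm_ge_zero[of "lattice_vec m"]]
        unfolding exp_le_cancel_iff by linarith
    qed (use C in simp)
    with c_decay[of m] show "norm (c m) \<le> (C * C') * exp (- sqrt (norm (lattice_vec m)))" by linarith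
  qed
  from lattice_series_coeff[OF this, of a] have "c a = 0" by (simp add: all)
  moreover have "ft u a \<noteq> 0" by (rule ft_neq_0[OF u(1,2) \<epsilon>a])
  ultimately show ?thesis by (simp add: c_def)
qed

text \<open>
This is part (b): a translate of Ingham's bump is carried over to the torus.
\<close>

lemma exists_supported_decaying:
  fixes U :: "(complex ^ 'n::finite) set" and \<Theta> :: "real \<Rightarrow> real"
  assumes nonneg: "\<And>r. 1 \<le> r \<Longrightarrow> 0 \<le> \<Theta> r"
    and dec: "\<And>r s. 1 \<le> r \<Longrightarrow> r \<le> s \<Longrightarrow> \<Theta> s \<le> \<Theta> r"
    and sum: "summable (\<lambda>k. \<Theta> (real (Suc k)) / real (Suc k))"
    and U: "openin (top_of_set torus) U" "U \<noteq> {}"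
  obtains f C where "torus_L1 f" "\<not> torus_AE (\<lambda>z. f z = 0)" "torus_support f \<subseteq> U"
    "\<And>m. norm (fourier_coeff f m) \<le> C * exp (- (\<Theta> (norm (lattice_vec m)) * norm (lattice_vec m)))"
proof -
  obtain p \<delta> where p: "0 < \<delta>" "ball p (2 * \<delta>) \<subseteq> box 0 (vec 1)" "torus_point ` ball p (2 * \<delta>) \<subseteq> U"
    by (rule torus_open_contains_ball[OF U])
  obtain u :: "real ^ 'n \<Rightarrow> real" and B C where u: "bump B \<delta> u" "0 < (LINT x | lborel. u x)"
    and decay: "\<And>m. norm (ft u m) \<le> C * exp (- (\<Theta> (norm (lattice_vec m)) * norm (lattice_vec m)))"
    by (rule ingham_bump[OF nonneg dec sum p(1)]) (assumption | rule that)+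
  have out: "u (x - p) = 0" if "x \<notin> cball p \<delta>" for x
    using u(1) that by (auto simp: bump_def dist_norm norm_minus_commute)
  have cb: "cball p \<delta> \<subseteq> ball p (2 * \<delta>)" using p(1) by auto
  \<comment> \<open>\<open>pre\<close> inverts \<open>torus_point\<close> on the half-open cube.  At a point of the cube with a coordinate 1
    it returns another point, but then the bump vanishes at both.\<close>
  define pre :: "complex ^ 'n \<Rightarrow> real ^ 'n" where "pre = (\<lambda>z. \<chi> i. Arg2pi (z $ i) / (2 * pi))"
  define f where "f = (\<lambda>z. complex_of_real (u (pre z - p)))"
  have Arg: "Arg2pi (exp (2 * of_real pi * \<i> * of_real t)) / (2 * pi) = (if t = 1 then 0 else t)" if "0 \<le> t" "t \<le> 1" for t
  proof (cases "t = 1")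
    case True then show ?thesis using Arg2pi_unique[of 1 0 1] by simp
  next
    case False
    have "Arg2pi (exp (2 * of_real pi * \<i> * of_real t)) = 2 * pi * t"
      by (rule Arg2pi_unique[of 1]) (use False that in \<open>auto simp: mult_ac\<close>)
    then show ?thesis using False by simp
  qed
  have f_eq: "f (torus_point x) = of_real (u (x - p))" if x: "x \<in> unit_cube" for x
  proof (cases "\<exists>i. x $ i = 1")
    case True
    then obtain i where i: "x $ i = 1" by blast
    have pi: "pre (torus_point x) $ i = 0"
      using Arg[of "x $ i"] i by (simp add: pre_def torus_point_def)
    have "x \<notin> box 0 (vec 1)" "pre (torus_point x) \<notin> box 0 (vec 1)"
      using i pi by (auto simp: mem_box_cart intro!: exI[of _ i])
    then have "u (x - p) = 0" "u (pre (torus_point x) - p) = 0"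
      using out cb p(2) by blast+
    then show ?thesis by (simp add: f_def)
  next
    case False
    then have "pre (torus_point x) = x"
      using x Arg by (simp add: vec_eq_iff pre_def torus_point_def mem_unit_cube)
    then show ?thesis by (simp add: f_def)
  qed
  have out_cube: "u (x - p) = 0" if "x \<notin> unit_cube" for x
    using that out cb p(2) box_subset_cbox[of 0 "vec 1 :: real ^ 'n"] unfolding unit_cube_def by blast
  note [measurable] = bump_measurable[OF u(1)]
  have coeff: "fourier_coeff f m = echar (- m) p * ft u m" for m
  proof -
    have "fourier_coeff f m = (LINT x | lebesgue_on unit_cube. of_real (u (x - p)) * echar (- m) x)"
      unfolding fourier_coeff_eq by (intro Bochner_Integration.integral_cong refl) (simp add: f_eq)
    also have "\<dots> = (LINT x | lborel. of_real (u (x - p)) * echar (- m) x)"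
      by (rule integral_cube_bump) (use out_cube in auto)
    also have "\<dots> = (LINT x | distr lborel borel ((+) p). of_real (u (x - p)) * echar (- m) x)"
      by (simp only: lborel_distr_plus)
    also have "\<dots> = (LINT x | lborel. of_real (u (p + x - p)) * echar (- m) (p + x))"
      by (rule integral_distr) measurable
    also have "\<dots> = (LINT x | lborel. echar (- m) p * (of_real (u x) * echar (- m) x))"
      by (simp add: echar_add mult_ac)
    also have "\<dots> = echar (- m) p * ft u m" by (simp add: ft_def)
    finally show ?thesis .
  qed
  have cont: "continuous_on UNIV (\<lambda>x. complex_of_real (u (x - p)))"
    by (intro continuous_intros continuous_on_compose2[OF bump_continuous[OF u(1), of UNIV]]) auto
  show ?thesis
  proof (rule that[of f C])
    show "torus_L1 f"
      unfolding torus_L1_def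
      using integrable_cube_continuous[OF cont]
      by (rule Bochner_Integration.integrable_cong[THEN iffD2, rotated -1]) (auto simp: f_eq)
    show "norm (fourier_coeff f m) \<le> C * exp (- (\<Theta> (norm (lattice_vec m)) * norm (lattice_vec m)))" for m
      using decay[of m] by (simp add: coeff norm_mult)
    show "\<not> torus_AE (\<lambda>z. f z = 0)"
    proof
      assume "torus_AE (\<lambda>z. f z = 0)"
      then have "AE x in lebesgue_on unit_cube. f (torus_point x) * echar (- 0) x = 0"
        by (simp add: torus_AE_def)
      then have "fourier_coeff f 0 = 0"
        unfolding fourier_coeff_eq by (rule integral_eq_zero_AE)
      then have "ft u 0 = 0" by (simp add: coeff)
      then show False using u(2) by (simp add: ft_def)
    qed
    have "{z \<in> torus. f z \<noteq> 0} \<subseteq> torus_point ` cball p \<delta>"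
    proof
      fix z assume z: "z \<in> {z \<in> torus. f z \<noteq> 0}"
      then obtain x where x: "z = torus_point x" "x \<in> unit_cube"
        unfolding torus_eq by (auto simp: mem_unit_cube)
      then have "u (x - p) \<noteq> 0" using z f_eq by auto
      then have "x \<in> cball p \<delta>" using out by blast
      then show "z \<in> torus_point ` cball p \<delta>" using x by blast
    qed
    moreover have "closed (torus_point ` cball p \<delta>)"
      by (intro compact_imp_closed compact_continuous_image continuous_on_torus_point) simp
    ultimately have "torus_support f \<subseteq> torus_point ` cball p \<delta>"
      unfolding torus_support_def by (rule closure_minimal)
    also have "\<dots> \<subseteq> U" using cb p(3) by blast
    finally show "torus_support f \<subseteq> U" .
  qed
qed

theorem theorem2p7:
  fixes \<theta> :: "real ^ 'n::finite \<Rightarrow> real"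
  assumes nonneg: "\<And>y. 0 \<le> \<theta> y"
    and radial: "radial \<theta>"
    and decreasing: "radially_decreasing \<theta>"
    and limit: "(\<theta> \<longlongrightarrow> 0) at_infinity"
  shows
    "(\<forall>(f :: complex ^ 'n \<Rightarrow> complex) U.
        torus_L1 f \<and> fourier_decay \<theta> f \<and>
        openin (top_of_set torus) U \<and> U \<noteq> {} \<and> torus_AE (\<lambda>z. z \<in> U \<longrightarrow> f z = 0) \<and>
        log_sum \<theta> = \<infinity>
        \<longrightarrow> torus_AE (\<lambda>z. f z = 0))
     \<and>
     (log_sum \<theta> < \<infinity> \<longrightarrow>
        (\<forall>U :: (complex ^ 'n) set. openin (top_of_set torus) U \<and> U \<noteq> {} \<longrightarrow>
           (\<exists>f. torus_L1 f \<and> \<not> torus_AE (\<lambda>z. f z = 0) \<and>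
                torus_support f \<subseteq> U \<and> fourier_decay \<theta> f)))"
proof -
  define \<Theta> where "\<Theta> = radial_value \<theta>"
  have \<Theta>_norm: "\<Theta> (norm y) = \<theta> y" for y unfolding \<Theta>_def by (rule radial_value_norm[OF radial])
  have \<Theta>_axis: "\<Theta> r = \<theta> (r *\<^sub>R axis undefined 1)" if "0 \<le> r" for r
    using \<Theta>_norm[of "r *\<^sub>R axis undefined 1"] that by simp
  have \<Theta>_nn: "0 \<le> \<Theta> r" if "1 \<le> r" for r using that nonneg by (simp add: \<Theta>_axis)
  have \<Theta>_dec: "\<Theta> s \<le> \<Theta> r" if "1 \<le> r" "r \<le> s" for r s
    using that decreasing by (simp add: \<Theta>_axis radially_decreasing_def)
  have decay: "fourier_decay \<theta> f \<longleftrightarrow> (\<exists>C. \<forall>m. norm (fourier_coeff f m) \<le> C * exp (- (\<Theta> (norm (lattice_vec m)) * norm (lattice_vec m))))" for f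
    by (simp add: fourier_decay_def \<Theta>_norm)
  let ?a = "\<lambda>k. \<Theta> (real (Suc k)) / real (Suc k)"
  have a_nn: "0 \<le> ?a k" for k using \<Theta>_nn[of "real (Suc k)"] by simp
  have log: "log_sum \<theta> = (\<Sum>k. ennreal (?a k))" by (simp add: log_sum_def \<Theta>_def)
  show ?thesis
  proof (intro conjI allI impI)
    fix f :: "complex ^ 'n \<Rightarrow> complex" and U
    assume H: "torus_L1 f \<and> fourier_decay \<theta> f \<and>
        openin (top_of_set torus) U \<and> U \<noteq> {} \<and> torus_AE (\<lambda>z. z \<in> U \<longrightarrow> f z = 0) \<and> log_sum \<theta> = \<infinity>"
    have div: "\<not> summable ?a"
      using H ennreal_suminf_neq_top[OF _ a_nn] by (auto simp: log)
    \<comment> \<open>A decreasing rate that reaches 0 has only finitely many nonzero terms in its sum.\<close>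
    have pos: "0 < \<Theta> r" if r: "1 \<le> r" for r
    proof (rule ccontr)
      assume "\<not> 0 < \<Theta> r"
      then have z: "\<Theta> s = 0" if "r \<le> s" for s
        using \<Theta>_dec[OF r that] \<Theta>_nn[of s] r that by linarith
      have "summable ?a"
      proof (rule summable_finite[of "{..nat \<lceil>r\<rceil>}"])
        fix k assume "k \<notin> {..nat \<lceil>r\<rceil>}"
        then have "r \<le> real (Suc k)" by simp linarith
        then show "?a k = 0" by (simp only: z div_0)
      qed simp
      with div show False by simp
    qed
    obtain C where C: "\<And>m. norm (fourier_coeff f m) \<le> C * exp (- (\<Theta> (norm (lattice_vec m)) * norm (lattice_vec m)))"
      using H by (auto simp: decay)
    obtain p \<delta> where p: "0 < \<delta>" "ball p (2 * \<delta>) \<subseteq> box 0 (vec 1)" "torus_point ` ball p (2 * \<delta>) \<subseteq> U"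
      by (rule torus_open_contains_ball[of U]) (use H in blast)+
    have "AE x in lebesgue_on unit_cube. torus_point x \<in> U \<longrightarrow> f (torus_point x) = 0"
      using H by (simp add: torus_AE_def)
    then have van: "AE x in lebesgue_on unit_cube. x \<in> ball p (2 * \<delta>) \<longrightarrow> f (torus_point x) = 0"
      by eventually_elim (use p(3) in blast)
    have "fourier_coeff f m = 0" for m
      by (rule fourier_coeff_eq_0[OF _ pos \<Theta>_dec div C p(1,2) van]) (use H in blast)+
    then have "(LINT x | lebesgue_on unit_cube. f (torus_point x) * echar m x) = 0" for m
      using fourier_coeff_eq[of f "- m"] by simp
    then show "torus_AE (\<lambda>z. f z = 0)"
      unfolding torus_AE_def using H by (intro fourier_uniqueness_cube) (auto simp: torus_L1_def)
  next
    fix U :: "(complex ^ 'n) set"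
    assume S: "log_sum \<theta> < \<infinity>" and U: "openin (top_of_set torus) U \<and> U \<noteq> {}"
    have "summable ?a" using S by (intro summable_suminf_not_top a_nn) (auto simp: log)
    then obtain f C where "torus_L1 f" "\<not> torus_AE (\<lambda>z. f z = 0)" "torus_support f \<subseteq> U"
      "\<And>m. norm (fourier_coeff f m) \<le> C * exp (- (\<Theta> (norm (lattice_vec m)) * norm (lattice_vec m)))"
      using exists_supported_decaying[of \<Theta> U] \<Theta>_nn \<Theta>_dec U by blast
    then show "\<exists>f. torus_L1 f \<and> \<not> torus_AE (\<lambda>z. f z = 0) \<and> torus_support f \<subseteq> U \<and> fourier_decay \<theta> f"
      by (auto simp: decay)
  qed
qed

end
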